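(* Consider a family of problems of varying size $n$, with matrices $A$, $W$, $Z$, $\Delta_F$ for each member. Assume that $P$ satisfies the weak approximation property (WAP) with respect to $A^*A$ with constant $C_P$, that (with $C_W = \sqrt{C_P(1+\|W\|^2)}$) $C_W\|\delta_R\|<\|A\|$ and $$\|G\| \leq \| \delta_F \| + \big(1+\|\delta_F\|\big) \frac{C_W\|\delta_R\|}{\|A\|-C_W\|\delta_R\|} \le \rho < 1,$$ and that the condition numbers of $A_{ff}$ and $\Delta_F$ are bounded independent of problem size. Then, for $k\geq 0$, $\|\mathcal{R}^k\|$ is bounded independent of problem size, and converges to $0$ as $k\to\infty$ with asymptotic rate at most $\rho$ (i.e. $\limsup_{k\to\infty}\|\mathcal{R}^k\|^{1/k}\le\rho$). If, in addition, $R^*$ satisfies the WAP with respect to $AA^*$, with constant $C_R$, then for $k\geq 0$, $\|\mathcal{E}^k\|$ is bounded independent of problem size, and converges to $0$ as $k\to\infty$ with asymptotic rate at most $\rho$ (i.e. $\limsup_{k\to\infty}\|\mathcal{E}^k\|^{1/k}\le\rho$).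
   Context: All norms are Euclidean ($\ell^2$) vector norms and induced operator norms; $^*$ denotes the adjoint (transpose). For each member of the family, $A\in\mathbb{R}^{n\times n}$ is nonsingular. The $n$ unknowns are partitioned into $n_f$ F-points and $n_c$ C-points, $n=n_f+n_c$, ordered with F-points first, and $$A = \begin{bmatrix} A_{ff} & A_{fc} \\ A_{cf} & A_{cc}\end{bmatrix},\qquad P = \begin{bmatrix} W \\ I\end{bmatrix},\qquad R = \begin{bmatrix} Z & I\end{bmatrix},$$ with $W\in\mathbb{R}^{n_f\times n_c}$ and $Z\in\mathbb{R}^{n_c\times n_f}$. The coarse-grid operator is $\mathcal{K} = RAP = ZA_{ff}W + A_{cf}W + ZA_{fc}+A_{cc}$, and $\Delta_F\in\mathbb{R}^{n_f\times n_f}$ is an approximation to $A_{ff}^{-1}$. The matrices $A_{ff}$, $\Delta_F$, $\mathcal{K}$ are nonsingular. $A$ is scaled so that $\|A\|$ is of order $1$ (bounded above and below by positive constants independent of problem size). Define $$\delta_F = I-\Delta_FA_{ff},\qquad \delta_P = A_{ff}W+A_{fc},\qquad \delta_R = ZA_{ff}+A_{cf},\qquad G = \delta_F + \Delta_F\delta_P\mathcal{K}^{-1} \delta_R .$$ The error- and residual-propagation matrices of one two-grid step (coarse-grid correction followed by F-relaxation) are $$\mathcal{E}=\left(I-\begin{bmatrix}\Delta_F&0\\0&0\end{bmatrix}A\right)\left(I-P\mathcal{K}^{-1}RA\right),\qquad \mathcal{R}=A\mathcal{E}A^{-1}.$$ WAP: for a symmetric positive definite matrix $\mathcal{A}\in\mathbb{R}^{n\times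 n}$, a matrix $Q\in\mathbb{R}^{n\times n_c}$ satisfies the weak approximation property with respect to $\mathcal{A}$, with constant $C$, if for every $\mathbf{v}\in\mathbb{R}^n$ there exists $\mathbf{w}_c\in\mathbb{R}^{n_c}$ such that $$\|\mathbf{v} - Q\mathbf{w}_c\|^2 \leq \frac{C}{\|\mathcal{A}\|} \langle \mathcal{A}\mathbf{v},\mathbf{v}\rangle .$$ Uniformity convention: $\rho<1$ is a fixed constant independent of problem size; $C_P$ and $\|W\|$ (hence $C_W$), and, in the second part, also $C_R$ and $\|Z\|$, are bounded independent of problem size. "Bounded independent of problem size" for a quantity depending on $k$ means bounded by one constant valid for all $k\ge0$ and all members of the family. *)

theory Defs
  imports
    "Jordan_Normal_Form.Gauss_Jordan_Elimination"
    "HOL-Library.Extended_Real"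
    "HOL-Library.Liminf_Limsup"
begin

text \<open>The size of a problem varies over a family, so matrices and vectors are those of
  Jordan_Normal_Form, whose dimensions are values and not types.\<close>

definition vec_norm2 :: "real vec \<Rightarrow> real" where
  "vec_norm2 v = sqrt (v \<bullet> v)"

text \<open>The supremum is over the closed unit ball, so that it is also meaningful (with value 0)
  when the matrix has no columns.\<close>

definition op_norm :: "real mat \<Rightarrow> real" where
  "op_norm M = (SUP v \<in> {v \<in> carrier_vec (dim_col M). vec_norm2 v \<le> 1}. vec_norm2 (M *\<^sub>v v))"

text \<open>This is the inverse for invertible matrices only; its value is unspecified otherwise.\<close>

definition mat_inv :: "real mat \<Rightarrow> real mat" where
  "mat_inv M = the (mat_inverse M)"

definition cond_num :: "real mat \<Rightarrow> real" where
  "cond_num M = op_norm M * op_norm (mat_inv M)"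

definition sym_pos_def :: "real mat \<Rightarrow> bool" where
  "sym_pos_def M \<longleftrightarrow> square_mat M \<and> transpose_mat M = M \<and>
     (\<forall>v \<in> carrier_vec (dim_row M). v \<noteq> 0\<^sub>v (dim_row M) \<longrightarrow> (M *\<^sub>v v) \<bullet> v > 0)"

definition weak_approx_property :: "real mat \<Rightarrow> real mat \<Rightarrow> real \<Rightarrow> bool" where
  "weak_approx_property M Q C \<longleftrightarrow> sym_pos_def M \<and> dim_row Q = dim_row M \<and>
     (\<forall>v \<in> carrier_vec (dim_row M). \<exists>w \<in> carrier_vec (dim_col Q).
        (vec_norm2 (v - Q *\<^sub>v w))\<^sup>2 \<le> C / op_norm M * ((M *\<^sub>v v) \<bullet> v))"

record two_grid =
  nF :: nat
  nC :: nat
  Aff :: "real mat"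
  Afc :: "real mat"
  Acf :: "real mat"
  Acc :: "real mat"
  Wmat :: "real mat"
  Zmat :: "real mat"
  DeltaF :: "real mat"

definition Amat :: "two_grid \<Rightarrow> real mat" where
  "Amat T = four_block_mat (Aff T) (Afc T) (Acf T) (Acc T)"

text \<open>The blocks of width or height 0 make these the stacked matrix [W; I] and the
  juxtaposed matrix [Z, I].\<close>

definition Pmat :: "two_grid \<Rightarrow> real mat" where
  "Pmat T = four_block_mat (Wmat T) (0\<^sub>m (nF T) 0) (1\<^sub>m (nC T)) (0\<^sub>m (nC T) 0)"

definition Rmat :: "two_grid \<Rightarrow> real mat" where
  "Rmat T = four_block_mat (Zmat T) (1\<^sub>m (nC T)) (0\<^sub>m 0 (nF T)) (0\<^sub>m 0 (nC T))"

definition Kmat :: "two_grid \<Rightarrow> real mat" where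
  "Kmat T = Rmat T * Amat T * Pmat T"

definition delta_F :: "two_grid \<Rightarrow> real mat" where
  "delta_F T = 1\<^sub>m (nF T) - DeltaF T * Aff T"

definition delta_P :: "two_grid \<Rightarrow> real mat" where
  "delta_P T = Aff T * Wmat T + Afc T"

definition delta_R :: "two_grid \<Rightarrow> real mat" where
  "delta_R T = Zmat T * Aff T + Acf T"

definition Gmat :: "two_grid \<Rightarrow> real mat" where
  "Gmat T = delta_F T + DeltaF T * delta_P T * mat_inv (Kmat T) * delta_R T"

definition F_relax :: "two_grid \<Rightarrow> real mat" where
  "F_relax T = four_block_mat (DeltaF T) (0\<^sub>m (nF T) (nC T))
                              (0\<^sub>m (nC T) (nF T)) (0\<^sub>m (nC T) (nC T))"

definition error_prop :: "two_grid \<Rightarrow> real mat" where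
  "error_prop T =
     (1\<^sub>m (nF T + nC T) - F_relax T * Amat T) *
     (1\<^sub>m (nF T + nC T) - Pmat T * mat_inv (Kmat T) * Rmat T * Amat T)"

definition residual_prop :: "two_grid \<Rightarrow> real mat" where
  "residual_prop T = Amat T * error_prop T * mat_inv (Amat T)"

definition two_grid_problem :: "two_grid \<Rightarrow> bool" where
  "two_grid_problem T \<longleftrightarrow>
     Aff T \<in> carrier_mat (nF T) (nF T) \<and> Afc T \<in> carrier_mat (nF T) (nC T) \<and>
     Acf T \<in> carrier_mat (nC T) (nF T) \<and> Acc T \<in> carrier_mat (nC T) (nC T) \<and>
     Wmat T \<in> carrier_mat (nF T) (nC T) \<and> Zmat T \<in> carrier_mat (nC T) (nF T) \<and>
     DeltaF T \<in> carrier_mat (nF T) (nF T) \<and>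
     invertible_mat (Amat T) \<and> invertible_mat (Aff T) \<and>
     invertible_mat (DeltaF T) \<and> invertible_mat (Kmat T)"

definition C_W :: "two_grid \<Rightarrow> real \<Rightarrow> real" where
  "C_W T C = sqrt (C * (1 + (op_norm (Wmat T))\<^sup>2))"

end

theory Submission
  imports Defs "HOL-Analysis.L2_Norm"
begin

text \<open>The error propagation of one two-grid step has rank at most the number of F-points, and the
  whole argument rests on factoring it through the F-points. Let \<open>F\<close> and \<open>C\<close> be the inclusions of
  the F- and C-points, so that \<open>P = F W + C\<close> and \<open>R = Z F\<^sup>T + C\<^sup>T\<close>, and let \<open>V = F\<^sup>T - W C\<^sup>T\<close>. Then
  \<open>V F = I\<close> and \<open>V P = 0\<close>: \<open>V\<close> measures how far a vector is from being interpolated from its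
  C-values. Coarse-grid correction annihilates the range of \<open>P\<close>, so it factors through \<open>V\<close>, and
  multiplying out the F-relaxation gives \<open>\<E> = U V\<close> with
  \<open>U = F G - P K\<^sup>-\<^sup>1 \<delta>\<^sub>R\<close>; moreover \<open>V U = G\<close>. Hence
  \<open>\<E>\<close> to the power \<open>k + 1\<close> is \<open>U G\<^sup>k V\<close>, and the same power of \<open>A \<E> A\<^sup>-\<^sup>1\<close> is
  \<open>(A U) G\<^sup>k (V A\<^sup>-\<^sup>1)\<close>. The middle factor decays like \<open>\<rho>\<^sup>k\<close>, because
  \<open>\<parallel>G\<parallel> \<le> \<rho>\<close>. It remains to bound the outer factors uniformly.

  The factor \<open>V A\<^sup>-\<^sup>1\<close>. Since \<open>V v = V (v - P w)\<close> for every \<open>w\<close>, the weak approximation property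
  bounds \<open>\<parallel>V v\<parallel>\<close> by \<open>C\<^sub>W / \<parallel>A\<parallel>\<close> times \<open>\<parallel>A v\<parallel>\<close> (\<open>wap_interp_defect_le\<close>). Applied to vectors supported on
  the F-points, where \<open>V\<close> is the identity, the same inequality turns \<open>C\<^sub>W \<parallel>\<delta>\<^sub>R\<parallel> < \<parallel>A\<parallel>\<close> into
  \<open>\<parallel>\<delta>\<^sub>R\<parallel> \<le> \<parallel>A\<parallel>\<close>.

  The factor \<open>A U\<close>. Let \<open>N = \<delta>\<^sub>P K\<^sup>-\<^sup>1 \<delta>\<^sub>R\<close>, and let \<open>J\<close> solve \<open>A\<^sub>f\<^sub>f J = N\<close>. As
  \<open>G = \<delta>\<^sub>F + \<Delta>\<^sub>F N\<close>, the matrix \<open>J\<close> satisfies \<open>J = \<delta>\<^sub>F J + (G - \<delta>\<^sub>F)\<close>, and as both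
  \<open>\<parallel>G\<parallel>\<close> and \<open>\<parallel>\<delta>\<^sub>F\<parallel>\<close> are at most \<open>\<rho>\<close>, this yields \<open>\<parallel>J\<parallel> \<le> 2 \<rho> / (1 - \<rho>)\<close>. Block elimination gives \<open>A U = A F (G - J) - C \<delta>\<^sub>R (I - J)\<close>, an
  expression in bounded matrices into which \<open>Z\<close> enters only through \<open>\<delta>\<^sub>R\<close> (\<open>A_lift\<close>).

  The factor \<open>U\<close>. A second form of the same identity reads
  \<open>U = A\<^sup>-\<^sup>1 (F - C Z) A\<^sub>f\<^sub>f (I - J) - F (I - G)\<close>. The transpose of \<open>A\<^sup>-\<^sup>1 (F - C Z)\<close> has the
  form \<open>V A\<^sup>-\<^sup>1\<close> with \<open>A\<^sup>T\<close> and \<open>Z\<^sup>T\<close> in place of \<open>A\<close> and \<open>W\<close>, so the weak approximation property of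
  \<open>R\<^sup>T\<close> bounds it. The factor \<open>V\<close> is bounded because \<open>W\<close> is.\<close>

section \<open>Euclidean and operator norms\<close>

lemma vec_norm2_L2: "vec_norm2 v = L2_set (\<lambda>i. v $ i) {0..<dim_vec v}"
  by (simp add: vec_norm2_def L2_set_def scalar_prod_def power2_eq_square)

lemma vec_norm2_nonneg [simp]: "0 \<le> vec_norm2 v"
  by (simp add: vec_norm2_L2)

lemma vec_norm2_sq: "(vec_norm2 v)\<^sup>2 = v \<bullet> v"
  by (simp add: vec_norm2_def scalar_prod_def sum_nonneg)

lemma vec_norm2_zero [simp]: "vec_norm2 (0\<^sub>v n) = 0"
  by (simp add: vec_norm2_def)

lemma vec_norm2_eq_0: "vec_norm2 v = 0 \<longleftrightarrow> v = 0\<^sub>v (dim_vec v)"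
proof
  assume "vec_norm2 v = 0"
  then show "v = 0\<^sub>v (dim_vec v)" by (intro eq_vecI) (auto simp: vec_norm2_L2 L2_set_eq_0_iff)
next
  assume "v = 0\<^sub>v (dim_vec v)"
  then show "vec_norm2 v = 0" by (rule ssubst) (rule vec_norm2_zero)
qed

lemma vec_norm2_triangle: "dim_vec v = dim_vec w \<Longrightarrow> vec_norm2 (v + w) \<le> vec_norm2 v + vec_norm2 w"
  using L2_set_triangle_ineq[of "\<lambda>i. v $ i" "\<lambda>i. w $ i" "{0..<dim_vec w}"]
  by (simp add: vec_norm2_L2 cong: L2_set_cong_simp)

lemma vec_norm2_smult: "vec_norm2 (c \<cdot>\<^sub>v v) = \<bar>c\<bar> * vec_norm2 v"
proof -
  have "vec_norm2 (c \<cdot>\<^sub>v v) = sqrt (c\<^sup>2 * (v \<bullet> v))"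
    by (simp add: vec_norm2_def power2_eq_square)
  then show ?thesis by (simp add: vec_norm2_def real_sqrt_mult)
qed

lemma vec_norm2_minus: "dim_vec v = dim_vec w \<Longrightarrow> vec_norm2 (v - w) \<le> vec_norm2 v + vec_norm2 w"
proof -
  assume d: "dim_vec v = dim_vec w"
  have "v - w = v + (-1) \<cdot>\<^sub>v w" using d by (intro eq_vecI) auto
  then show ?thesis using vec_norm2_triangle[of v "(-1) \<cdot>\<^sub>v w"] d by (simp add: vec_norm2_smult)
qed

lemma scalar_prod_le: assumes "dim_vec v = dim_vec w" shows "\<bar>v \<bullet> w\<bar> \<le> vec_norm2 v * vec_norm2 w"
proof -
  have "\<bar>v \<bullet> w\<bar> \<le> (\<Sum>i\<in>{0..<dim_vec w}. \<bar>v $ i\<bar> * \<bar>w $ i\<bar>)"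
    unfolding scalar_prod_def by (rule order_trans[OF sum_abs]) (simp add: abs_mult)
  also have "\<dots> \<le> vec_norm2 v * vec_norm2 w"
    using L2_set_mult_ineq[of "\<lambda>i. v $ i" "\<lambda>i. w $ i" "{0..<dim_vec w}"] assms by (simp add: vec_norm2_L2)
  finally show ?thesis .
qed

lemma mult_mat_vec_bounded:
  "\<exists>B. \<forall>v \<in> carrier_vec (dim_col M). vec_norm2 (M *\<^sub>v v) \<le> B * vec_norm2 v"
proof (intro exI ballI)
  fix v :: "real vec" assume v: "v \<in> carrier_vec (dim_col M)"
  have "vec_norm2 (M *\<^sub>v v) \<le> (\<Sum>i\<in>{0..<dim_row M}. \<bar>row M i \<bullet> v\<bar>)"
    using L2_set_le_sum_abs[of "\<lambda>i. (M *\<^sub>v v) $ i" "{0..<dim_row M}"] by (simp add: vec_norm2_L2)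
  also have "\<dots> \<le> (\<Sum>i\<in>{0..<dim_row M}. vec_norm2 (row M i) * vec_norm2 v)"
    using v by (intro sum_mono scalar_prod_le) auto
  finally show "vec_norm2 (M *\<^sub>v v) \<le> (\<Sum>i\<in>{0..<dim_row M}. vec_norm2 (row M i)) * vec_norm2 v"
    by (simp add: sum_distrib_right)
qed

text \<open>A supremum of reals is meaningful only for a set that is bounded above; this is what
  makes the defining supremum of \<open>op_norm\<close> behave as the operator norm.\<close>

lemma op_norm_bdd: "bdd_above ((\<lambda>v. vec_norm2 (M *\<^sub>v v)) ` {v \<in> carrier_vec (dim_col M). vec_norm2 v \<le> 1})"
proof -
  obtain B where B: "\<And>v. v \<in> carrier_vec (dim_col M) \<Longrightarrow> vec_norm2 (M *\<^sub>v v) \<le> B * vec_norm2 v"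
    using mult_mat_vec_bounded by blast
  have "vec_norm2 (M *\<^sub>v v) \<le> \<bar>B\<bar>" if "v \<in> carrier_vec (dim_col M)" "vec_norm2 v \<le> 1" for v
  proof -
    have "B * vec_norm2 v \<le> \<bar>B\<bar> * vec_norm2 v" by (intro mult_right_mono) auto
    also have "\<dots> \<le> \<bar>B\<bar> * 1" using that by (intro mult_left_mono) auto
    finally show ?thesis using B[OF that(1)] by simp
  qed
  then show ?thesis by (intro bdd_aboveI2[where M="\<bar>B\<bar>"]) auto
qed

lemma op_norm_nonneg [simp]: "0 \<le> op_norm M"
proof -
  have "vec_norm2 (M *\<^sub>v 0\<^sub>v (dim_col M)) \<le> op_norm M"
    unfolding op_norm_def by (rule cSUP_upper[OF _ op_norm_bdd]) auto
  then show ?thesis using vec_norm2_nonneg order_trans by blast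
qed

lemma op_norm_bound:
  assumes v: "v \<in> carrier_vec (dim_col M)"
  shows "vec_norm2 (M *\<^sub>v v) \<le> op_norm M * vec_norm2 v"
proof (cases "vec_norm2 v = 0")
  case True
  then have "v = 0\<^sub>v (dim_col M)" using v by (simp add: vec_norm2_eq_0)
  moreover have "M *\<^sub>v 0\<^sub>v (dim_col M) = 0\<^sub>v (dim_row M)" by (intro eq_vecI) auto
  ultimately show ?thesis by simp
next
  case False
  define u where "u = (1 / vec_norm2 v) \<cdot>\<^sub>v v"
  have u: "u \<in> carrier_vec (dim_col M)" "vec_norm2 u \<le> 1"
    using v False by (auto simp: u_def vec_norm2_smult)
  have "vec_norm2 (M *\<^sub>v u) \<le> op_norm M"
    unfolding op_norm_def by (rule cSUP_upper[OF _ op_norm_bdd]) (use u in auto)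
  moreover have "M *\<^sub>v u = (1 / vec_norm2 v) \<cdot>\<^sub>v (M *\<^sub>v v)"
    unfolding u_def using v by (intro mult_mat_vec) auto
  moreover have "0 < vec_norm2 v" using False vec_norm2_nonneg[of v] by linarith
  ultimately show ?thesis by (simp add: vec_norm2_smult pos_divide_le_eq)
qed

lemma op_norm_leI:
  assumes "0 \<le> c" "\<And>v. v \<in> carrier_vec (dim_col M) \<Longrightarrow> vec_norm2 (M *\<^sub>v v) \<le> c * vec_norm2 v"
  shows "op_norm M \<le> c"
  unfolding op_norm_def
proof (rule cSUP_least)
  show "{v \<in> carrier_vec (dim_col M). vec_norm2 v \<le> 1} \<noteq> {}"
    by (auto intro!: exI[of _ "0\<^sub>v (dim_col M)"])
next
  fix v :: "real vec" assume "v \<in> {v \<in> carrier_vec (dim_col M). vec_norm2 v \<le> 1}"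
  then have "vec_norm2 (M *\<^sub>v v) \<le> c * vec_norm2 v" "c * vec_norm2 v \<le> c * 1"
    using assms(2)[of v] mult_left_mono[of "vec_norm2 v" 1 c] assms(1) by auto
  then show "vec_norm2 (M *\<^sub>v v) \<le> c" by simp
qed

lemma op_norm_mult:
  assumes "dim_col M = dim_row N"
  shows "op_norm (M * N) \<le> op_norm M * op_norm N"
proof (rule op_norm_leI)
  fix v :: "real vec" assume "v \<in> carrier_vec (dim_col (M * N))"
  then have v: "v \<in> carrier_vec (dim_col N)" by simp
  have "(M * N) *\<^sub>v v = M *\<^sub>v (N *\<^sub>v v)"
    using v assms by (intro assoc_mult_mat_vec[where ?n\<^sub>1.0="dim_row M"]) auto
  also have "vec_norm2 \<dots> \<le> op_norm M * vec_norm2 (N *\<^sub>v v)"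
    using assms by (intro op_norm_bound carrier_vecI) simp
  also have "\<dots> \<le> op_norm M * (op_norm N * vec_norm2 v)"
    by (intro mult_left_mono op_norm_bound v) auto
  finally show "vec_norm2 (M * N *\<^sub>v v) \<le> op_norm M * op_norm N * vec_norm2 v" by (simp add: ac_simps)
qed auto

lemma op_norm_add:
  assumes "dim_row M = dim_row N" "dim_col M = dim_col N"
  shows "op_norm (M + N) \<le> op_norm M + op_norm N"
proof (rule op_norm_leI)
  fix v :: "real vec" assume "v \<in> carrier_vec (dim_col (M + N))"
  then have v: "v \<in> carrier_vec (dim_col N)" "v \<in> carrier_vec (dim_col M)" using assms by auto
  have "(M + N) *\<^sub>v v = M *\<^sub>v v + N *\<^sub>v v"
    using v assms by (intro add_mult_distrib_mat_vec[where nr="dim_row M"]) auto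
  also have "vec_norm2 \<dots> \<le> vec_norm2 (M *\<^sub>v v) + vec_norm2 (N *\<^sub>v v)"
    using assms by (intro vec_norm2_triangle) auto
  finally show "vec_norm2 ((M + N) *\<^sub>v v) \<le> (op_norm M + op_norm N) * vec_norm2 v"
    using op_norm_bound[OF v(1)] op_norm_bound[OF v(2)] by (simp add: distrib_right)
qed auto

lemma op_norm_minus:
  assumes "dim_row M = dim_row N" "dim_col M = dim_col N"
  shows "op_norm (M - N) \<le> op_norm M + op_norm N"
proof (rule op_norm_leI)
  fix v :: "real vec" assume "v \<in> carrier_vec (dim_col (M - N))"
  then have v: "v \<in> carrier_vec (dim_col N)" "v \<in> carrier_vec (dim_col M)" using assms by auto
  have "(M - N) *\<^sub>v v = M *\<^sub>v v - N *\<^sub>v v"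
    using v assms by (intro minus_mult_distrib_mat_vec[where nr="dim_row M"]) auto
  also have "vec_norm2 \<dots> \<le> vec_norm2 (M *\<^sub>v v) + vec_norm2 (N *\<^sub>v v)"
    using assms by (intro vec_norm2_minus) auto
  finally show "vec_norm2 ((M - N) *\<^sub>v v) \<le> (op_norm M + op_norm N) * vec_norm2 v"
    using op_norm_bound[OF v(1)] op_norm_bound[OF v(2)] by (simp add: distrib_right)
qed auto

lemma op_norm_one: "op_norm (1\<^sub>m n) \<le> 1"
proof (rule op_norm_leI)
  fix v :: "real vec" assume "v \<in> carrier_vec (dim_col (1\<^sub>m n))"
  then have "v \<in> carrier_vec n" by simp
  then have "1\<^sub>m n *\<^sub>v v = v" by (rule one_mult_mat_vec)
  then show "vec_norm2 (1\<^sub>m n *\<^sub>v v) \<le> 1 * vec_norm2 v" by simp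
qed simp

lemma mult_mat_vec_scalar:
  fixes M :: "real mat"
  assumes "v \<in> carrier_vec (dim_col M)" "w \<in> carrier_vec (dim_row M)"
  shows "(M *\<^sub>v v) \<bullet> w = v \<bullet> (M\<^sup>T *\<^sub>v w)"
proof -
  have "M\<^sup>T \<in> carrier_mat (dim_col M) (dim_row M)" by simp
  from transpose_vec_mult_scalar[OF this assms(2,1)] show ?thesis by simp
qed

text \<open>With \<open>u = M\<^sup>T v\<close>, the square of the norm of \<open>u\<close> is the inner product of \<open>M u\<close> and \<open>v\<close>,
  so one factor \<open>\<parallel>u\<parallel>\<close> cancels.\<close>

lemma op_norm_transpose_le: "op_norm (M\<^sup>T) \<le> op_norm M"
proof (rule op_norm_leI)
  fix v :: "real vec" assume "v \<in> carrier_vec (dim_col M\<^sup>T)"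
  then have v: "v \<in> carrier_vec (dim_row M)" by simp
  define u where "u = M\<^sup>T *\<^sub>v v"
  have u: "u \<in> carrier_vec (dim_col M)" unfolding u_def by (intro carrier_vecI) (simp del: mult_mat_vec_carrier)
  have "(vec_norm2 u)\<^sup>2 = (M *\<^sub>v u) \<bullet> v"
    using mult_mat_vec_scalar[OF u v] by (simp add: vec_norm2_sq u_def)
  also have "\<dots> \<le> vec_norm2 (M *\<^sub>v u) * vec_norm2 v"
    using scalar_prod_le[of "M *\<^sub>v u" v] v by auto
  also have "\<dots> \<le> (op_norm M * vec_norm2 u) * vec_norm2 v"
    by (intro mult_right_mono op_norm_bound u) auto
  finally have "vec_norm2 u * vec_norm2 u \<le> (op_norm M * vec_norm2 v) * vec_norm2 u"
    by (simp add: power2_eq_square ac_simps)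
  then show "vec_norm2 (M\<^sup>T *\<^sub>v v) \<le> op_norm M * vec_norm2 v"
    unfolding u_def[symmetric]
    by (cases "vec_norm2 u = 0") (simp_all add: less_le)
qed auto

lemma op_norm_transpose [simp]: "op_norm (M\<^sup>T) = op_norm M"
  using op_norm_transpose_le[of M] op_norm_transpose_le[of "M\<^sup>T"] by simp

lemma normal_mat_scalar:
  fixes M :: "real mat"
  assumes "v \<in> carrier_vec (dim_col M)"
  shows "((M\<^sup>T * M) *\<^sub>v v) \<bullet> v = (vec_norm2 (M *\<^sub>v v))\<^sup>2"
proof -
  have "(M\<^sup>T * M) *\<^sub>v v = M\<^sup>T *\<^sub>v (M *\<^sub>v v)"
    using assms by (intro assoc_mult_mat_vec[where ?n\<^sub>1.0="dim_col M"]) auto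
  moreover have "M *\<^sub>v v \<in> carrier_vec (dim_col M\<^sup>T)" by (intro carrier_vecI) simp
  ultimately show ?thesis
    using mult_mat_vec_scalar[of "M *\<^sub>v v" "M\<^sup>T" v] assms by (simp add: vec_norm2_sq)
qed

text \<open>Half of the C*-identity, which is what replaces the norm of \<open>A\<^sup>T A\<close> in the weak
  approximation property by the square of the norm of \<open>A\<close>.\<close>

lemma op_norm_normal_mat_ge: "(op_norm M)\<^sup>2 \<le> op_norm (M\<^sup>T * M)"
proof -
  have "op_norm M \<le> sqrt (op_norm (M\<^sup>T * M))"
  proof (rule op_norm_leI)
    fix v :: "real vec" assume v: "v \<in> carrier_vec (dim_col M)"
    have "(vec_norm2 (M *\<^sub>v v))\<^sup>2 = ((M\<^sup>T * M) *\<^sub>v v) \<bullet> v" using normal_mat_scalar[OF v] by simp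
    also have "\<dots> \<le> vec_norm2 ((M\<^sup>T * M) *\<^sub>v v) * vec_norm2 v"
      using scalar_prod_le[of "(M\<^sup>T * M) *\<^sub>v v" v] v by auto
    also have "\<dots> \<le> (op_norm (M\<^sup>T * M) * vec_norm2 v) * vec_norm2 v"
      using v by (intro mult_right_mono op_norm_bound) auto
    also have "\<dots> = (sqrt (op_norm (M\<^sup>T * M)) * vec_norm2 v)\<^sup>2"
      by (simp add: power2_eq_square[of "vec_norm2 v"] power_mult_distrib)
    finally show "vec_norm2 (M *\<^sub>v v) \<le> sqrt (op_norm (M\<^sup>T * M)) * vec_norm2 v"
      by (rule power2_le_imp_le) auto
  qed auto
  then have "(op_norm M)\<^sup>2 \<le> (sqrt (op_norm (M\<^sup>T * M)))\<^sup>2" by (rule power_mono) simp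
  then show ?thesis by simp
qed

section \<open>Matrix algebra\<close>

text \<open>The laws of matrix algebra, with hypotheses about dimensions only. All variables in
  the hypotheses occur in the left-hand side, so the simplifier can normalise products of
  rectangular matrices as in a noncommutative ring.\<close>

lemma mat_assoc_dim:
  fixes A B C :: "real mat"
  shows "dim_col A = dim_row B \<Longrightarrow> dim_col B = dim_row C \<Longrightarrow> A * B * C = A * (B * C)"
  by (rule assoc_mult_mat[where ?n\<^sub>1.0="dim_row A" and ?n\<^sub>4.0="dim_col C"]) auto

lemma mat_distrib_dim:
  fixes A B C :: "real mat"
  shows "dim_col A = dim_row C \<Longrightarrow> dim_row A = dim_row B \<Longrightarrow> dim_col A = dim_col B \<Longrightarrow> (A + B) * C = A * C + B * C"
    and "dim_col A = dim_row C \<Longrightarrow> dim_row A = dim_row B \<Longrightarrow> dim_col A = dim_col B \<Longrightarrow> (A - B) * C = A * C - B * C"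
    and "dim_col C = dim_row A \<Longrightarrow> dim_row A = dim_row B \<Longrightarrow> dim_col A = dim_col B \<Longrightarrow> C * (A + B) = C * A + C * B"
    and "dim_col C = dim_row A \<Longrightarrow> dim_row A = dim_row B \<Longrightarrow> dim_col A = dim_col B \<Longrightarrow> C * (A - B) = C * A - C * B"
     apply (rule add_mult_distrib_mat[where nr="dim_row A" and nc="dim_col C"]; auto)
    apply (rule minus_mult_distrib_mat[where nr="dim_row A" and nc="dim_col C"]; auto)
   apply (rule mult_add_distrib_mat[where nr="dim_row C" and nc="dim_col A"]; auto)
  apply (rule mult_minus_distrib_mat[where nr="dim_row C" and nc="dim_col A"]; auto)
  done

lemma mat_one_dim:
  fixes A :: "real mat"
  shows "dim_row A = n \<Longrightarrow> 1\<^sub>m n * A = A" "dim_col A = n \<Longrightarrow> A * 1\<^sub>m n = A"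
  using left_mult_one_mat'[of A n] right_mult_one_mat'[of A n] by auto

lemma mat_zero_dim:
  fixes M :: "real mat"
  shows "dim_col M = n \<Longrightarrow> M * 0\<^sub>m n k = 0\<^sub>m (dim_row M) k"
    and "dim_row M = n \<Longrightarrow> 0\<^sub>m k n * M = 0\<^sub>m k (dim_col M)"
    and "dim_row M = m \<Longrightarrow> dim_col M = n \<Longrightarrow> M + 0\<^sub>m m n = M"
    and "dim_row M = m \<Longrightarrow> dim_col M = n \<Longrightarrow> 0\<^sub>m m n + M = M"
    and "dim_row M = m \<Longrightarrow> dim_col M = n \<Longrightarrow> M - 0\<^sub>m m n = M"
    and "M - M = 0\<^sub>m (dim_row M) (dim_col M)"
  by (intro eq_matI; simp)+

lemmas mat_ring_simps = mat_assoc_dim mat_distrib_dim mat_one_dim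

lemma transpose_mult_dim:
  fixes A B :: "real mat"
  shows "dim_col A = dim_row B \<Longrightarrow> (A * B)\<^sup>T = B\<^sup>T * A\<^sup>T"
  by (rule transpose_mult[where nr="dim_row A" and nc="dim_col B"]) auto

lemma mat_vec_dim:
  fixes A B :: "real mat"
  shows "dim_col A = dim_row B \<Longrightarrow> dim_col B = dim_vec v \<Longrightarrow> (A * B) *\<^sub>v v = A *\<^sub>v (B *\<^sub>v v)"
  by (rule assoc_mult_mat_vec[where ?n\<^sub>1.0="dim_row A"]) (auto intro: carrier_vecI)

text \<open>The two dimensions of a two-sided inverse are forced by the two products being
  identity matrices, so the abstract inverse is a unit of the matrix ring, for which the
  elimination procedure returns a value.\<close>

lemma mat_inv_inverse:
  assumes A: "A \<in> carrier_mat n n" and inv: "invertible_mat A"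
  shows "mat_inv A \<in> carrier_mat n n" "A * mat_inv A = 1\<^sub>m n" "mat_inv A * A = 1\<^sub>m n"
proof -
  obtain B where B: "A * B = 1\<^sub>m (dim_row A)" "B * A = 1\<^sub>m (dim_row B)"
    using inv by (auto simp: invertible_mat_def inverts_mat_def)
  have "dim_col (B * A) = dim_row B" "dim_col (A * B) = dim_row A" unfolding B by simp_all
  then have "B \<in> carrier_mat n n" using A by auto
  then have "A \<in> Units (ring_mat TYPE(real) n n)"
    using A B unfolding Units_def ring_mat_def by auto
  then obtain C where "mat_inverse A = Some C"
    using mat_inverse(1)[OF A] by fastforce
  then show "mat_inv A \<in> carrier_mat n n" "A * mat_inv A = 1\<^sub>m n" "mat_inv A * A = 1\<^sub>m n"
    using mat_inverse(2)[OF A, of C] by (simp_all add: mat_inv_def)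
qed

section \<open>Inclusions of the F- and C-points\<close>

text \<open>The isometric inclusions of the F-points and of the C-points into the set of all
  unknowns. All block matrices are written with them, so that block computations
  become computations in the algebra generated by these inclusions and the blocks.\<close>

definition incl_F :: "nat \<Rightarrow> nat \<Rightarrow> real mat" where
  "incl_F f c = mat (f + c) f (\<lambda>(i, j). if i = j then 1 else 0)"

definition incl_C :: "nat \<Rightarrow> nat \<Rightarrow> real mat" where
  "incl_C f c = mat (f + c) c (\<lambda>(i, j). if i = f + j then 1 else 0)"

lemma incl_dim [simp]:
  "dim_row (incl_F f c) = f + c" "dim_col (incl_F f c) = f"
  "dim_row (incl_C f c) = f + c" "dim_col (incl_C f c) = c"
  by (simp_all add: incl_F_def incl_C_def)

lemma incl_mult:
  "dim_row M = f \<Longrightarrow> incl_F f c * M = mat (f + c) (dim_col M) (\<lambda>(i, j). if i < f then M $$ (i, j) else 0)"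
  "dim_row M = c \<Longrightarrow> incl_C f c * M = mat (f + c) (dim_col M) (\<lambda>(i, j). if i < f then 0 else M $$ (i - f, j))"
proof -
  assume "dim_row M = f"
  then show "incl_F f c * M = mat (f + c) (dim_col M) (\<lambda>(i, j). if i < f then M $$ (i, j) else 0)"
    by (intro eq_matI) (auto simp: incl_F_def scalar_prod_def if_distrib[of "\<lambda>x. x * _"] sum.delta cong: if_cong)
next
  assume d: "dim_row M = c"
  have *: "(\<Sum>k = 0..<c. (if i = f + k then 1 else 0) * M $$ (k, j)) = (if i < f then 0 else M $$ (i - f, j))"
    if "i < f + c" for i j
  proof -
    have "(if i = f + k then 1 else 0) * M $$ (k, j) = (if k = i - f then if i < f then 0 else M $$ (k, j) else 0)" for k
      by auto
    then show ?thesis using that by (auto simp: sum.delta)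
  qed
  show "incl_C f c * M = mat (f + c) (dim_col M) (\<lambda>(i, j). if i < f then 0 else M $$ (i - f, j))"
    using d * by (intro eq_matI) (auto simp: incl_C_def scalar_prod_def)
qed

lemma incl_transpose_mult:
  "dim_row M = f + c \<Longrightarrow> (incl_F f c)\<^sup>T * M = mat f (dim_col M) (\<lambda>(i, j). M $$ (i, j))"
  "dim_row M = f + c \<Longrightarrow> (incl_C f c)\<^sup>T * M = mat c (dim_col M) (\<lambda>(i, j). M $$ (f + i, j))"
  by (intro eq_matI; auto simp: incl_F_def incl_C_def scalar_prod_def if_distrib[of "\<lambda>x. x * _"] sum.delta' sum.delta cong: if_cong)+

lemma mult_incl_transpose:
  assumes "dim_col M = f"
  shows "M * (incl_F f c)\<^sup>T = mat (dim_row M) (f + c) (\<lambda>(i, j). if j < f then M $$ (i, j) else 0)"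
proof -
  have "M * (incl_F f c)\<^sup>T = (incl_F f c * M\<^sup>T)\<^sup>T"
    using assms by (simp add: transpose_mult_dim)
  then show ?thesis using assms by (simp add: incl_mult) (auto intro!: eq_matI)
qed

lemma mult_incl_C_transpose:
  assumes "dim_col M = c"
  shows "M * (incl_C f c)\<^sup>T = mat (dim_row M) (f + c) (\<lambda>(i, j). if j < f then 0 else M $$ (i, j - f))"
proof -
  have "M * (incl_C f c)\<^sup>T = (incl_C f c * M\<^sup>T)\<^sup>T"
    using assms by (simp add: transpose_mult_dim)
  then show ?thesis using assms by (simp add: incl_mult) (auto intro!: eq_matI)
qed

lemma incl_ortho:
  "(incl_F f c)\<^sup>T * incl_F f c = 1\<^sub>m f" "(incl_C f c)\<^sup>T * incl_C f c = 1\<^sub>m c"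
  "(incl_F f c)\<^sup>T * incl_C f c = 0\<^sub>m f c" "(incl_C f c)\<^sup>T * incl_F f c = 0\<^sub>m c f"
  by (simp_all add: incl_transpose_mult, simp_all add: incl_F_def incl_C_def) (auto intro!: eq_matI)

text \<open>Inserted into a product, this identity performs the splitting into blocks.\<close>

lemma incl_resolution:
  "incl_F f c * (incl_F f c)\<^sup>T + incl_C f c * (incl_C f c)\<^sup>T = 1\<^sub>m (f + c)"
proof -
  have F: "incl_F f c * (incl_F f c)\<^sup>T = mat (f + c) (f + c) (\<lambda>(i, j). if i < f then (incl_F f c)\<^sup>T $$ (i, j) else 0)"
    by (subst incl_mult) simp_all
  have C: "incl_C f c * (incl_C f c)\<^sup>T = mat (f + c) (f + c) (\<lambda>(i, j). if i < f then 0 else (incl_C f c)\<^sup>T $$ (i - f, j))"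
    by (subst incl_mult) simp_all
  show ?thesis
    unfolding F C by (intro eq_matI) (auto simp: incl_F_def incl_C_def)
qed

lemma four_block_incl:
  assumes "M \<in> carrier_mat f f" "N \<in> carrier_mat f c" "K \<in> carrier_mat c f" "L \<in> carrier_mat c c"
  shows "four_block_mat M N K L =
    incl_F f c * (M * (incl_F f c)\<^sup>T + N * (incl_C f c)\<^sup>T) + incl_C f c * (K * (incl_F f c)\<^sup>T + L * (incl_C f c)\<^sup>T)"
  using assms by (intro eq_matI) (auto simp: mult_incl_transpose mult_incl_C_transpose incl_mult)

lemma four_block_col_incl:
  assumes "W \<in> carrier_mat f c"
  shows "four_block_mat W (0\<^sub>m f 0) (1\<^sub>m c) (0\<^sub>m c 0) = incl_F f c * W + incl_C f c"
  using assms by (intro eq_matI) (auto simp: incl_mult incl_C_def)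

lemma four_block_row_incl:
  assumes "Z \<in> carrier_mat c f"
  shows "four_block_mat Z (1\<^sub>m c) (0\<^sub>m 0 f) (0\<^sub>m 0 c) = Z * (incl_F f c)\<^sup>T + (incl_C f c)\<^sup>T"
  using assms by (intro eq_matI) (auto simp: mult_incl_transpose incl_C_def)

lemma incl_ortho_assoc:
  "dim_row X = f \<Longrightarrow> (incl_F f c)\<^sup>T * (incl_F f c * X) = X"
  "dim_row X = c \<Longrightarrow> (incl_C f c)\<^sup>T * (incl_C f c * X) = X"
  "dim_row X = c \<Longrightarrow> (incl_F f c)\<^sup>T * (incl_C f c * X) = 0\<^sub>m f (dim_col X)"
  "dim_row X = f \<Longrightarrow> (incl_C f c)\<^sup>T * (incl_F f c * X) = 0\<^sub>m c (dim_col X)"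
  by (subst mat_assoc_dim[symmetric]; simp add: incl_ortho mat_one_dim mat_zero_dim)+

lemmas incl_simps = incl_ortho incl_ortho_assoc mat_zero_dim

lemma vec_norm2_incl:
  "dim_vec x = f \<Longrightarrow> vec_norm2 (incl_F f c *\<^sub>v x) = vec_norm2 x"
  "dim_vec x = c \<Longrightarrow> vec_norm2 (incl_C f c *\<^sub>v x) = vec_norm2 x"
proof -
  have isometry: "vec_norm2 (M *\<^sub>v x) = vec_norm2 x"
    if "M\<^sup>T * M = 1\<^sub>m (dim_col M)" "dim_vec x = dim_col M" for M :: "real mat" and x
  proof -
    have x: "x \<in> carrier_vec (dim_col M)" using that by (intro carrier_vecI) simp
    have "(vec_norm2 (M *\<^sub>v x))\<^sup>2 = (vec_norm2 x)\<^sup>2"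
      using normal_mat_scalar[OF x] x by (simp add: that(1) vec_norm2_sq)
    then show ?thesis by (simp add: power2_eq_iff_nonneg)
  qed
  show "dim_vec x = f \<Longrightarrow> vec_norm2 (incl_F f c *\<^sub>v x) = vec_norm2 x"
    and "dim_vec x = c \<Longrightarrow> vec_norm2 (incl_C f c *\<^sub>v x) = vec_norm2 x"
    by (rule isometry; simp add: incl_ortho)+
qed

lemma op_norm_incl: "op_norm (incl_F f c) \<le> 1" "op_norm (incl_C f c) \<le> 1"
  by (rule op_norm_leI; simp add: vec_norm2_incl)+

lemma vec_norm2_split:
  assumes x: "x \<in> carrier_vec (f + c)"
  shows "(vec_norm2 x)\<^sup>2 = (vec_norm2 ((incl_F f c)\<^sup>T *\<^sub>v x))\<^sup>2 + (vec_norm2 ((incl_C f c)\<^sup>T *\<^sub>v x))\<^sup>2"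
proof -
  let ?F = "incl_F f c" and ?C = "incl_C f c"
  have dx: "dim_vec x = f + c" using x by simp
  have "x = (?F * ?F\<^sup>T + ?C * ?C\<^sup>T) *\<^sub>v x"
    unfolding incl_resolution by (rule one_mult_mat_vec[symmetric, OF x])
  also have "\<dots> = ?F *\<^sub>v (?F\<^sup>T *\<^sub>v x) + ?C *\<^sub>v (?C\<^sup>T *\<^sub>v x)"
    using x by (subst add_mult_distrib_mat_vec[where nr="f + c" and nc="f + c"]) (auto simp: mat_vec_dim)
  finally have "x \<bullet> x = (?F *\<^sub>v (?F\<^sup>T *\<^sub>v x) + ?C *\<^sub>v (?C\<^sup>T *\<^sub>v x)) \<bullet> x" by (rule arg_cong)
  also have "\<dots> = (?F *\<^sub>v (?F\<^sup>T *\<^sub>v x)) \<bullet> x + (?C *\<^sub>v (?C\<^sup>T *\<^sub>v x)) \<bullet> x"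
    by (rule add_scalar_prod_distrib[where n="f + c"]) (use dx in \<open>auto intro!: carrier_vecI\<close>)
  also have "(?F *\<^sub>v (?F\<^sup>T *\<^sub>v x)) \<bullet> x = (?F\<^sup>T *\<^sub>v x) \<bullet> (?F\<^sup>T *\<^sub>v x)"
    by (rule mult_mat_vec_scalar) (use dx in \<open>auto intro!: carrier_vecI\<close>)
  also have "(?C *\<^sub>v (?C\<^sup>T *\<^sub>v x)) \<bullet> x = (?C\<^sup>T *\<^sub>v x) \<bullet> (?C\<^sup>T *\<^sub>v x)"
    by (rule mult_mat_vec_scalar) (use dx in \<open>auto intro!: carrier_vecI\<close>)
  finally show ?thesis by (simp add: vec_norm2_sq)
qed

section \<open>The weak approximation property\<close>

text \<open>The matrix \<open>[I, -W]\<close>: it maps a vector to the difference between its F-values and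
  those interpolated from its C-values.\<close>

definition interp_defect :: "nat \<Rightarrow> nat \<Rightarrow> real mat \<Rightarrow> real mat" where
  "interp_defect f c W = (incl_F f c)\<^sup>T - W * (incl_C f c)\<^sup>T"

lemma interp_defect_dim [simp]:
  "dim_row (interp_defect f c W) = dim_row W" "dim_col (interp_defect f c W) = f + c"
  by (simp_all add: interp_defect_def)

lemma interp_defect_incl_F:
  assumes "W \<in> carrier_mat f c" shows "interp_defect f c W * incl_F f c = 1\<^sub>m f"
  using assms by (simp add: interp_defect_def mat_ring_simps incl_simps)

lemma interp_defect_interp:
  assumes "W \<in> carrier_mat f c"
  shows "interp_defect f c W * (incl_F f c * W + incl_C f c) = 0\<^sub>m f c"
  using assms by (simp add: interp_defect_def mat_ring_simps incl_simps) (intro eq_matI; simp)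

text \<open>The difference of a vector and the interpolant of its C-values is supported on the F-points.
  In this proof, as in others below, the entries of products are left alone once all products are
  expanded; what remains is an identity between sums of atomic terms.\<close>

lemma interp_defect_resolution:
  assumes "W \<in> carrier_mat f c"
  shows "incl_F f c * interp_defect f c W + (incl_F f c * W + incl_C f c) * (incl_C f c)\<^sup>T = 1\<^sub>m (f + c)"
  unfolding incl_resolution[symmetric]
  using assms by (simp add: interp_defect_def mat_ring_simps) (intro eq_matI; simp del: index_mult_mat(1))

text \<open>The Cauchy-Schwarz inequality for \<open>p + w q\<close>, where \<open>p\<close> and \<open>q\<close> are the norms of the
  F-part and of the C-part.\<close>

lemma interp_defect_vec_le:
  assumes W: "W \<in> carrier_mat f c" and x: "x \<in> carrier_vec (f + c)"
  shows "vec_norm2 (interp_defect f c W *\<^sub>v x) \<le> sqrt (1 + (op_norm W)\<^sup>2) * vec_norm2 x"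
proof -
  define p q w where "p = vec_norm2 ((incl_F f c)\<^sup>T *\<^sub>v x)"
    and "q = vec_norm2 ((incl_C f c)\<^sup>T *\<^sub>v x)" and "w = op_norm W"
  have "interp_defect f c W *\<^sub>v x = (incl_F f c)\<^sup>T *\<^sub>v x - W *\<^sub>v ((incl_C f c)\<^sup>T *\<^sub>v x)"
    unfolding interp_defect_def
    using x W by (subst minus_mult_distrib_mat_vec[where nr=f and nc="f + c"]) (auto simp: mat_vec_dim)
  also have "vec_norm2 \<dots> \<le> p + vec_norm2 (W *\<^sub>v ((incl_C f c)\<^sup>T *\<^sub>v x))"
    unfolding p_def using W by (intro vec_norm2_minus) simp
  also have "\<dots> \<le> p + w * q"
    unfolding q_def w_def using W by (intro add_left_mono op_norm_bound carrier_vecI) simp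
  also have "\<dots> \<le> sqrt ((1 + w\<^sup>2) * (p\<^sup>2 + q\<^sup>2))"
  proof (rule real_le_rsqrt)
    have "0 \<le> (w * p - q)\<^sup>2" by simp
    then show "(p + w * q)\<^sup>2 \<le> (1 + w\<^sup>2) * (p\<^sup>2 + q\<^sup>2)"
      by (simp add: power2_eq_square algebra_simps)
  qed
  also have "p\<^sup>2 + q\<^sup>2 = (vec_norm2 x)\<^sup>2"
    using vec_norm2_split[OF x] by (simp add: p_def q_def)
  finally show ?thesis by (simp add: real_sqrt_mult w_def)
qed

lemma op_norm_interp_defect:
  assumes "W \<in> carrier_mat f c"
  shows "op_norm (interp_defect f c W) \<le> sqrt (1 + (op_norm W)\<^sup>2)"
  using interp_defect_vec_le[OF assms] by (intro op_norm_leI) simp_all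

text \<open>A negative constant would make the right-hand side of the weak approximation
  property negative for a vector not annihilated by \<open>B\<close>.\<close>

lemma wap_const_nonneg:
  assumes wap: "weak_approx_property (B\<^sup>T * B) Q C" and B: "0 < op_norm B"
  shows "0 \<le> C"
proof (rule ccontr)
  assume "\<not> 0 \<le> C"
  have pos: "0 < op_norm (B\<^sup>T * B)"
    using op_norm_normal_mat_ge[of B] B zero_less_power[OF B, of 2] by linarith
  have "op_norm B \<le> 0"
  proof (rule op_norm_leI)
    fix v :: "real vec" assume v: "v \<in> carrier_vec (dim_col B)"
    then obtain w where
      "(vec_norm2 (v - Q *\<^sub>v w))\<^sup>2 \<le> C / op_norm (B\<^sup>T * B) * (((B\<^sup>T * B) *\<^sub>v v) \<bullet> v)"
      using wap unfolding weak_approx_property_def by auto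
    then have "0 \<le> C / op_norm (B\<^sup>T * B) * (vec_norm2 (B *\<^sub>v v))\<^sup>2"
      unfolding normal_mat_scalar[OF v] by (rule order_trans[rotated]) simp
    moreover have "C / op_norm (B\<^sup>T * B) < 0" using pos \<open>\<not> 0 \<le> C\<close> by (simp add: divide_neg_pos)
    ultimately have "\<not> 0 < (vec_norm2 (B *\<^sub>v v))\<^sup>2"
      using mult_neg_pos not_le by blast
    then have "vec_norm2 (B *\<^sub>v v) = 0" by simp
    then show "vec_norm2 (B *\<^sub>v v) \<le> 0 * vec_norm2 v" by simp
  qed simp
  then show False using B by simp
qed

text \<open>The way in which the weak approximation property is used: subtracting an element of
  the range of \<open>[W; I]\<close> does not change the image under \<open>[I, -W]\<close>, so the best approximation
  from that range may be subtracted first.\<close>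

lemma wap_interp_defect_le:
  assumes W: "W \<in> carrier_mat f c" and B: "dim_col B = f + c" "0 < op_norm B"
    and wap: "weak_approx_property (B\<^sup>T * B) (incl_F f c * W + incl_C f c) C"
    and v: "v \<in> carrier_vec (f + c)"
  shows "vec_norm2 (interp_defect f c W *\<^sub>v v)
      \<le> sqrt (C * (1 + (op_norm W)\<^sup>2)) / op_norm B * vec_norm2 (B *\<^sub>v v)"
proof -
  let ?V = "interp_defect f c W" and ?P = "incl_F f c * W + incl_C f c"
  have C: "0 \<le> C" by (rule wap_const_nonneg[OF wap B(2)])
  have vB: "v \<in> carrier_vec (dim_col B)" using v B by simp
  obtain w where w: "w \<in> carrier_vec c" and
    "(vec_norm2 (v - ?P *\<^sub>v w))\<^sup>2 \<le> C / op_norm (B\<^sup>T * B) * (((B\<^sup>T * B) *\<^sub>v v) \<bullet> v)"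
    using wap vB unfolding weak_approx_property_def by auto
  then have "(vec_norm2 (v - ?P *\<^sub>v w))\<^sup>2 \<le> C / op_norm (B\<^sup>T * B) * (vec_norm2 (B *\<^sub>v v))\<^sup>2"
    by (simp only: normal_mat_scalar[OF vB])
  also have "\<dots> \<le> C / (op_norm B)\<^sup>2 * (vec_norm2 (B *\<^sub>v v))\<^sup>2"
  proof -
    have "0 < (op_norm B)\<^sup>2" using B(2) by (rule zero_less_power)
    moreover from this have "0 < op_norm (B\<^sup>T * B)"
      using op_norm_normal_mat_ge[of B] by (rule less_le_trans)
    ultimately show ?thesis
      using op_norm_normal_mat_ge[of B] C
      by (intro mult_right_mono divide_left_mono mult_pos_pos) auto
  qed
  also have "\<dots> = (sqrt C / op_norm B * vec_norm2 (B *\<^sub>v v))\<^sup>2"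
    using C by (simp add: power_mult_distrib power_divide)
  finally have le: "vec_norm2 (v - ?P *\<^sub>v w) \<le> sqrt C / op_norm B * vec_norm2 (B *\<^sub>v v)"
    by (rule power2_le_imp_le) (use C in auto)
  have dims: "dim_vec v = f + c" "dim_vec w = c" using v w by simp_all
  have "?V *\<^sub>v (v - ?P *\<^sub>v w) = ?V *\<^sub>v v - (?V * ?P) *\<^sub>v w"
    using v w W by (subst mult_minus_distrib_mat_vec[where nr=f and nc="f + c"])
      (auto simp: mat_vec_dim intro!: carrier_vecI)
  also have "\<dots> = ?V *\<^sub>v v"
    unfolding interp_defect_interp[OF W] using W w v by (intro eq_vecI) auto
  finally have "vec_norm2 (?V *\<^sub>v v) = vec_norm2 (?V *\<^sub>v (v - ?P *\<^sub>v w))" by simp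
  also have "\<dots> \<le> sqrt (1 + (op_norm W)\<^sup>2) * vec_norm2 (v - ?P *\<^sub>v w)"
    by (rule interp_defect_vec_le[OF W]) (use dims W in \<open>auto intro!: carrier_vecI\<close>)
  also have "\<dots> \<le> sqrt (1 + (op_norm W)\<^sup>2) * (sqrt C / op_norm B * vec_norm2 (B *\<^sub>v v))"
    by (intro mult_left_mono le) simp
  finally show ?thesis by (simp add: real_sqrt_mult ac_simps)
qed

lemma wap_interp_defect_inverse:
  assumes W: "W \<in> carrier_mat f c" and B: "B \<in> carrier_mat (f + c) (f + c)" "0 < op_norm B"
    and Bi: "Bi \<in> carrier_mat (f + c) (f + c)" "B * Bi = 1\<^sub>m (f + c)"
    and wap: "weak_approx_property (B\<^sup>T * B) (incl_F f c * W + incl_C f c) C"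
  shows "op_norm (interp_defect f c W * Bi) \<le> sqrt (C * (1 + (op_norm W)\<^sup>2)) / op_norm B"
proof (rule op_norm_leI)
  show "0 \<le> sqrt (C * (1 + (op_norm W)\<^sup>2)) / op_norm B"
    using wap_const_nonneg[OF wap B(2)] by simp
  fix x :: "real vec" assume "x \<in> carrier_vec (dim_col (interp_defect f c W * Bi))"
  then have x: "x \<in> carrier_vec (f + c)" using Bi by simp
  have "vec_norm2 (interp_defect f c W *\<^sub>v (Bi *\<^sub>v x))
      \<le> sqrt (C * (1 + (op_norm W)\<^sup>2)) / op_norm B * vec_norm2 (B *\<^sub>v (Bi *\<^sub>v x))"
    by (rule wap_interp_defect_le[OF W _ B(2) wap]) (use B Bi in \<open>auto intro!: carrier_vecI\<close>)
  moreover have "B *\<^sub>v (Bi *\<^sub>v x) = x"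
    using B Bi x one_mult_mat_vec[OF x] mat_vec_dim[of B Bi x] by simp
  moreover have "(interp_defect f c W * Bi) *\<^sub>v x = interp_defect f c W *\<^sub>v (Bi *\<^sub>v x)"
    using Bi x by (intro mat_vec_dim) auto
  ultimately show "vec_norm2 ((interp_defect f c W * Bi) *\<^sub>v x)
      \<le> sqrt (C * (1 + (op_norm W)\<^sup>2)) / op_norm B * vec_norm2 x" by simp
qed

section \<open>Powers of a factored matrix\<close>

text \<open>In a power of \<open>U V\<close> the inner factors regroup to \<open>V U\<close>.\<close>

lemma pow_mat_factored:
  fixes U V :: "real mat"
  assumes "dim_col U = dim_row V" "dim_col V = dim_row U"
  shows "(U * V) ^\<^sub>m Suc k = U * ((V * U) ^\<^sub>m k * V)"
proof (induction k)
  case 0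
  show ?case using assms by (simp add: mat_one_dim)
next
  case (Suc k)
  have "(U * V) ^\<^sub>m Suc (Suc k) = (U * ((V * U) ^\<^sub>m k * V)) * (U * V)"
    using Suc.IH by simp
  also have "\<dots> = U * ((V * U) ^\<^sub>m Suc k * V)"
    using assms by (simp add: mat_assoc_dim)
  finally show ?case .
qed

lemma op_norm_pow_le:
  assumes "dim_row G = dim_col G" "op_norm G \<le> r"
  shows "op_norm (G ^\<^sub>m k) \<le> r ^ k"
proof (induction k)
  case 0 show ?case by (simp add: op_norm_one)
next
  case (Suc k)
  have "op_norm (G ^\<^sub>m Suc k) \<le> op_norm (G ^\<^sub>m k) * op_norm G"
    using assms by (simp add: op_norm_mult)
  also have "\<dots> \<le> r ^ k * r"
    using Suc assms(2) order_trans[OF op_norm_nonneg assms(2)] by (intro mult_mono) auto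
  finally show ?case by (simp add: mult.commute)
qed

text \<open>The \<open>k\<close>-th root of the constant tends to 1, so only the ratio survives in the limit.\<close>

lemma geometric_seq_rate:
  fixes s :: "nat \<Rightarrow> real"
  assumes nonneg: "\<And>k. 0 \<le> s k" and le: "\<And>k. s (Suc k) \<le> c * r ^ k" and r: "0 \<le> r" "r < 1"
  shows "s \<longlonglongrightarrow> 0" and "limsup (\<lambda>k. ereal (root k (s k))) \<le> ereal r"
proof -
  have "(\<lambda>k. c * r ^ k) \<longlonglongrightarrow> c * 0"
    using r by (intro tendsto_mult_left LIMSEQ_power_zero) simp
  then have lim: "(\<lambda>k. c * r ^ k) \<longlonglongrightarrow> 0" by simp
  have "(\<lambda>k. s (Suc k)) \<longlonglongrightarrow> 0"
    by (rule tendsto_sandwich[OF _ _ tendsto_const lim]) (simp_all add: nonneg le)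
  then show "s \<longlonglongrightarrow> 0" by (simp add: filterlim_sequentially_Suc)
  have c: "0 \<le> c" using order_trans[OF nonneg le[of 0]] by simp
  \<comment> \<open>For a zero ratio the constant cannot be moved to the exponent \<open>k\<close> by a division, but then
    \<open>s k\<close> vanishes for all \<open>k \<ge> 2\<close>.\<close>
  show "limsup (\<lambda>k. ereal (root k (s k))) \<le> ereal r"
  proof (cases "r = 0")
    case True
    have "root k (s k) = 0" if "2 \<le> k" for k
    proof -
      obtain m where k: "k = Suc (Suc m)" using \<open>2 \<le> k\<close> by (metis add_2_eq_Suc le_Suc_ex)
      have "s k = 0" using nonneg[of k] le[of "Suc m"] True unfolding k by simp
      then show ?thesis by simp
    qed
    then have "eventually (\<lambda>k. ereal (root k (s k)) \<le> ereal r) sequentially"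
      using True by (intro eventually_sequentiallyI[of 2]) simp
    then show ?thesis by (intro Limsup_bounded)
  next
    case False
    then have r0: "0 < r" using r by simp
    \<comment> \<open>The summand 1 keeps the constant positive, as the limit of its roots requires.\<close>
    have "(\<lambda>k. root k ((c + 1) / r) * r) \<longlonglongrightarrow> 1 * r"
      using r0 c by (intro tendsto_mult_right LIMSEQ_root_const) simp
    then have lim: "limsup (\<lambda>k. ereal (root k ((c + 1) / r) * r)) = ereal r"
      by (intro lim_imp_Limsup) simp_all
    have "root k (s k) \<le> root k ((c + 1) / r) * r" if "1 \<le> k" for k
    proof -
      obtain m where k: "k = Suc m" using \<open>1 \<le> k\<close> by (cases k) auto
      have "s k \<le> c * r ^ m" using le[of m] by (simp add: k)
      also have "\<dots> \<le> (c + 1) * r ^ m" using r by (intro mult_right_mono) auto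
      also have "\<dots> = (c + 1) / r * r ^ k" using r0 by (simp add: k)
      finally have "root k (s k) \<le> root k ((c + 1) / r * r ^ k)" using k by simp
      also have "\<dots> = root k ((c + 1) / r) * r"
        using r0 k by (simp only: real_root_mult) (simp add: real_root_power_cancel del: power_Suc)
      finally show ?thesis .
    qed
    then have "eventually (\<lambda>k. ereal (root k (s k)) \<le> ereal (root k ((c + 1) / r) * r)) sequentially"
      by (intro eventually_sequentiallyI[of 1]) simp
    then have "limsup (\<lambda>k. ereal (root k (s k))) \<le> limsup (\<lambda>k. ereal (root k ((c + 1) / r) * r))"
      by (rule Limsup_mono)
    then show ?thesis unfolding lim .
  qed
qed

text \<open>The two outer factors contribute a constant and the inner one the geometric decay.
  The power 0 is not of the factored form; it accounts for the summand 1 in the uniform bound.\<close>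

lemma uniform_power_convergence:
  fixes X :: "'i \<Rightarrow> real mat"
  assumes X: "\<And>i. X i = U i * V i" and G: "\<And>i. V i * U i = G i"
    and dims: "\<And>i. dim_col (U i) = dim_row (V i)" "\<And>i. dim_col (V i) = dim_row (U i)"
    and U: "\<And>i. op_norm (U i) \<le> u" and V: "\<And>i. op_norm (V i) \<le> v"
    and r: "\<And>i. op_norm (G i) \<le> r" "r < 1"
  shows "(\<exists>M. \<forall>i k. op_norm (X i ^\<^sub>m k) \<le> M) \<and>
    (\<forall>i. (\<lambda>k. op_norm (X i ^\<^sub>m k)) \<longlonglongrightarrow> 0) \<and>
    (\<forall>i. limsup (\<lambda>k. ereal (root k (op_norm (X i ^\<^sub>m k)))) \<le> ereal r)"
proof -
  have u0: "0 \<le> u" and v0: "0 \<le> v" and r0: "0 \<le> r"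
    using order_trans[OF op_norm_nonneg U] order_trans[OF op_norm_nonneg V]
      order_trans[OF op_norm_nonneg r(1)] by blast+
  have step: "op_norm (X i ^\<^sub>m Suc k) \<le> (u * v) * r ^ k" for i k
  proof -
    have GiD: "dim_row (G i) = dim_row (V i)" "dim_col (G i) = dim_row (V i)"
      using dims[of i] by (simp_all flip: G)
    have "op_norm (X i ^\<^sub>m Suc k) = op_norm (U i * (G i ^\<^sub>m k * V i))"
      unfolding X pow_mat_factored[OF dims] G ..
    also have "\<dots> \<le> op_norm (U i) * op_norm (G i ^\<^sub>m k * V i)"
      using dims[of i] GiD by (intro op_norm_mult) simp
    also have "\<dots> \<le> op_norm (U i) * (op_norm (G i ^\<^sub>m k) * op_norm (V i))"
      using GiD by (intro mult_left_mono op_norm_mult) simp_all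
    also have "\<dots> \<le> u * (r ^ k * v)"
      using u0 v0 r0 GiD by (intro mult_mono U V op_norm_pow_le r) simp_all
    finally show ?thesis by (simp add: ac_simps)
  qed
  have "op_norm (X i ^\<^sub>m k) \<le> 1 + u * v" for i k
  proof (cases k)
    case 0
    have "op_norm (X i ^\<^sub>m k) \<le> 1" by (simp add: 0 op_norm_one)
    then show ?thesis using u0 v0 by (simp add: add_increasing2)
  next
    case (Suc m)
    have "(u * v) * r ^ m \<le> (u * v) * 1"
      using u0 v0 r0 r(2) by (intro mult_left_mono power_le_one) auto
    then show ?thesis using step[of i m] Suc by simp
  qed
  then show ?thesis
    using geometric_seq_rate[where s="\<lambda>k. op_norm (X _ ^\<^sub>m k)", OF op_norm_nonneg step r0 r(2)] by blast
qed

section \<open>The two-grid step\<close>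

locale two_grid_step =
  fixes T :: two_grid
  assumes problem: "two_grid_problem T"
begin

abbreviation (input) "f \<equiv> nF T"
abbreviation (input) "c \<equiv> nC T"
abbreviation "F \<equiv> incl_F (nF T) (nC T)"
abbreviation "C \<equiv> incl_C (nF T) (nC T)"
abbreviation "A \<equiv> Amat T"
abbreviation "W \<equiv> Wmat T"
abbreviation "Z \<equiv> Zmat T"
abbreviation "P \<equiv> Pmat T"
abbreviation "R \<equiv> Rmat T"
abbreviation "K \<equiv> Kmat T"
abbreviation "K' \<equiv> mat_inv (Kmat T)"
abbreviation "\<Delta> \<equiv> DeltaF T"
abbreviation "G \<equiv> Gmat T"
abbreviation "V \<equiv> interp_defect (nF T) (nC T) (Wmat T)"

lemma block_carriers:
  "Aff T \<in> carrier_mat f f" "Afc T \<in> carrier_mat f c" "Acf T \<in> carrier_mat c f" "Acc T \<in> carrier_mat c c"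
  "W \<in> carrier_mat f c" "Z \<in> carrier_mat c f" "\<Delta> \<in> carrier_mat f f"
  using problem by (simp_all add: two_grid_problem_def)

lemma block_dims [simp]:
  "dim_row (Aff T) = f" "dim_col (Aff T) = f" "dim_row (Afc T) = f" "dim_col (Afc T) = c"
  "dim_row (Acf T) = c" "dim_col (Acf T) = f" "dim_row (Acc T) = c" "dim_col (Acc T) = c"
  "dim_row W = f" "dim_col W = c" "dim_row Z = c" "dim_col Z = f" "dim_row \<Delta> = f" "dim_col \<Delta> = f"
  using block_carriers by auto

lemma A_eq: "A = F * (Aff T * F\<^sup>T + Afc T * C\<^sup>T) + C * (Acf T * F\<^sup>T + Acc T * C\<^sup>T)"
  unfolding Amat_def by (rule four_block_incl) (rule block_carriers)+

lemma P_eq: "P = F * W + C"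
  unfolding Pmat_def by (rule four_block_col_incl) (rule block_carriers)

lemma R_eq: "R = Z * F\<^sup>T + C\<^sup>T"
  unfolding Rmat_def by (rule four_block_row_incl) (rule block_carriers)

lemma F_relax_eq: "F_relax T = F * (\<Delta> * F\<^sup>T)"
  unfolding F_relax_def
  by (subst four_block_incl[where f=f and c=c]) (simp_all add: block_carriers mat_zero_dim)

lemma composite_dims [simp]:
  "dim_row A = f + c" "dim_col A = f + c" "dim_row P = f + c" "dim_col P = c"
  "dim_row R = c" "dim_col R = f + c" "dim_row K = c" "dim_col K = c"
  by (simp_all add: A_eq P_eq R_eq Kmat_def)

lemma A_F: "A * F = F * Aff T + C * Acf T"
  by (simp add: A_eq mat_ring_simps incl_simps)

lemma A_C: "A * C = F * Afc T + C * Acc T"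
  by (simp add: A_eq mat_ring_simps incl_simps)

lemma inverses:
  "A * mat_inv A = 1\<^sub>m (f + c)" "mat_inv A * A = 1\<^sub>m (f + c)" "mat_inv A \<in> carrier_mat (f + c) (f + c)"
  "Aff T * mat_inv (Aff T) = 1\<^sub>m f" "mat_inv (Aff T) \<in> carrier_mat f f"
  "K * K' = 1\<^sub>m c" "K' * K = 1\<^sub>m c" "K' \<in> carrier_mat c c"
proof -
  have inv: "invertible_mat A" "invertible_mat (Aff T)" "invertible_mat K"
    using problem by (simp_all add: two_grid_problem_def)
  have "A \<in> carrier_mat (f + c) (f + c)" "K \<in> carrier_mat c c" by (intro carrier_matI; simp)+
  then show "A * mat_inv A = 1\<^sub>m (f + c)" "mat_inv A * A = 1\<^sub>m (f + c)"
    "mat_inv A \<in> carrier_mat (f + c) (f + c)"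
    "Aff T * mat_inv (Aff T) = 1\<^sub>m f" "mat_inv (Aff T) \<in> carrier_mat f f"
    "K * K' = 1\<^sub>m c" "K' * K = 1\<^sub>m c" "K' \<in> carrier_mat c c"
    using inv block_carriers by (simp_all add: mat_inv_inverse)
qed

lemma inverse_dims [simp]:
  "dim_row (mat_inv A) = f + c" "dim_col (mat_inv A) = f + c"
  "dim_row (mat_inv (Aff T)) = f" "dim_col (mat_inv (Aff T)) = f"
  "dim_row K' = c" "dim_col K' = c"
  using inverses by auto

lemma inverse_cancel:
  "dim_row X = c \<Longrightarrow> K * (K' * X) = X"
  "dim_row X = f \<Longrightarrow> Aff T * (mat_inv (Aff T) * X) = X"
  "dim_row X = f + c \<Longrightarrow> A * (mat_inv A * X) = X" "dim_row X = f + c \<Longrightarrow> mat_inv A * (A * X) = X"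
  by (subst mat_assoc_dim[symmetric]; simp add: inverses mat_one_dim)+

lemma delta_dims [simp]:
  "dim_row (delta_R T) = c" "dim_col (delta_R T) = f" "dim_row (delta_P T) = f" "dim_col (delta_P T) = c"
  "dim_row (delta_F T) = f" "dim_col (delta_F T) = f" "dim_row G = f" "dim_col G = f"
  by (simp_all add: delta_R_def delta_P_def delta_F_def Gmat_def)

lemma delta_R_eq: "R * (A * F) = delta_R T"
  by (simp add: R_eq A_F delta_R_def mat_ring_simps incl_simps)

lemma delta_P_eq: "F\<^sup>T * (A * P) = delta_P T"
proof -
  have "A * P = (A * F) * W + A * C" by (simp add: P_eq mat_ring_simps)
  then show ?thesis by (simp add: A_F A_C delta_P_def mat_ring_simps incl_simps)
qed

lemma Aff_eq: "F\<^sup>T * (A * F) = Aff T"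
  by (simp add: A_F mat_ring_simps incl_simps)

text \<open>These are the matrices \<open>K\<^sup>-\<^sup>1 \<delta>\<^sub>R\<close>, \<open>N\<close>, \<open>U\<close> and \<open>J\<close> of the introduction.
  The difference \<open>A\<^sub>f\<^sub>f - N\<close> plays the role of a Schur complement: it is the operator on the F-points that
  remains after the coarse-grid correction. The matrix \<open>J\<close> is \<open>N\<close> measured
  relative to \<open>A\<^sub>f\<^sub>f\<close>.\<close>

definition "coarse_term = K' * delta_R T"
definition "schur_term = delta_P T * coarse_term"
definition "lift = F * G - P * coarse_term"
definition "rel_schur_term = mat_inv (Aff T) * schur_term"

lemma factor_dims [simp]:
  "dim_row coarse_term = c" "dim_col coarse_term = f" "dim_row schur_term = f" "dim_col schur_term = f"
  "dim_row lift = f + c" "dim_col lift = f" "dim_row rel_schur_term = f" "dim_col rel_schur_term = f"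
  by (simp_all add: coarse_term_def schur_term_def lift_def rel_schur_term_def)

lemma G_eq: "G = delta_F T + \<Delta> * schur_term"
  by (simp add: Gmat_def schur_term_def coarse_term_def mat_ring_simps)

lemma K_coarse_term: "K * coarse_term = delta_R T"
  by (simp add: coarse_term_def inverse_cancel)

lemma V_lift: "V * lift = G"
proof -
  have "V * lift = (V * F) * G - (V * P) * coarse_term"
    by (simp add: lift_def mat_ring_simps)
  then show ?thesis
    by (simp add: P_eq interp_defect_incl_F interp_defect_interp block_carriers mat_one_dim mat_zero_dim)
qed

text \<open>The coarse-grid correction \<open>X\<close> annihilates \<open>P\<close>, so inserting \<open>I = F V + P C\<^sup>T\<close> on its
  right leaves \<open>X F V\<close>. The F-relaxation then turns \<open>X F\<close> into \<open>U\<close>.\<close>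

lemma error_prop_factored: "error_prop T = lift * V"
proof -
  define X where "X = 1\<^sub>m (f + c) - P * K' * R * A"
  have dX [simp]: "dim_row X = f + c" "dim_col X = f + c" by (simp_all add: X_def)
  have RAP: "R * (A * P) = K" by (simp add: Kmat_def mat_assoc_dim)
  have XP: "X * P = 0\<^sub>m (f + c) c"
    by (simp add: X_def mat_ring_simps RAP inverses mat_zero_dim)
  have XF: "X * F = F - P * coarse_term"
    by (simp add: X_def mat_ring_simps delta_R_eq coarse_term_def)
  have "X = X * (F * V + P * C\<^sup>T)"
    by (simp add: P_eq interp_defect_resolution block_carriers mat_one_dim)
  also have "\<dots> = (X * F) * V + (X * P) * C\<^sup>T"
    by (simp add: mat_ring_simps)
  also have "\<dots> = (F - P * coarse_term) * V"
    by (simp add: XP XF mat_zero_dim)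
  finally have X: "X = (F - P * coarse_term) * V" .
  have relax: "(1\<^sub>m (f + c) - F_relax T * A) * (F - P * coarse_term) = lift"
  proof -
    have "F\<^sup>T * (A * (P * coarse_term)) = (F\<^sup>T * (A * P)) * coarse_term"
      by (simp add: mat_assoc_dim)
    then have schur_term: "F\<^sup>T * (A * (P * coarse_term)) = schur_term" by (simp add: delta_P_eq schur_term_def)
    show ?thesis
      by (simp add: F_relax_eq mat_ring_simps Aff_eq schur_term lift_def G_eq delta_F_def)
        (intro eq_matI; simp del: index_mult_mat(1))
  qed
  have "error_prop T = (1\<^sub>m (f + c) - F_relax T * A) * ((F - P * coarse_term) * V)"
    unfolding error_prop_def X[symmetric] X_def ..
  also have "\<dots> = lift * V"
    unfolding relax[symmetric] by (simp add: mat_assoc_dim F_relax_eq)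
  finally show ?thesis .
qed

lemma residual_prop_factored: "residual_prop T = (A * lift) * (V * mat_inv A)"
  by (simp add: residual_prop_def error_prop_factored mat_assoc_dim)

lemma V_inv_A_lift: "(V * mat_inv A) * (A * lift) = G"
  by (simp add: mat_assoc_dim inverse_cancel V_lift)

text \<open>Multiplying \<open>A\<^sub>f\<^sub>f J = N\<close> by \<open>\<Delta>\<^sub>F\<close> gives \<open>(I - \<delta>\<^sub>F) J = G - \<delta>\<^sub>F\<close>. As \<open>\<parallel>\<delta>\<^sub>F\<parallel> < 1\<close>,
  the matrix \<open>J\<close> is controlled by \<open>G\<close> and \<open>\<delta>\<^sub>F\<close>.\<close>

lemma rel_schur_term_fixed_point: "rel_schur_term = delta_F T * rel_schur_term + (G - delta_F T)"
proof -
  have "Aff T * rel_schur_term = schur_term" by (simp add: rel_schur_term_def inverse_cancel)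
  then have "delta_F T * rel_schur_term = rel_schur_term - \<Delta> * schur_term"
    by (simp add: delta_F_def mat_ring_simps)
  then show ?thesis
    by (simp add: G_eq) (intro eq_matI; simp del: index_mult_mat(1))
qed

text \<open>Two expressions for \<open>A U\<close>. In the first, inverses enter only through \<open>G\<close> and \<open>J\<close>, and
  \<open>Z\<close> otherwise only through \<open>\<delta>\<^sub>R\<close>. The second starts with \<open>F - C Z\<close>, whose columns
  span the null space of \<open>R\<close>;
  this is the form to which the approximation property of \<open>R\<^sup>T\<close> applies after multiplication
  by \<open>A\<^sup>-\<^sup>1\<close>. Both follow from \<open>A P = F \<delta>\<^sub>P + C (K - Z \<delta>\<^sub>P)\<close>.\<close>

lemma A_lift:
  "A * lift = A * (F * (G - rel_schur_term)) - C * (delta_R T * (1\<^sub>m f - rel_schur_term))"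
  "A * lift = (F - C * Z) * (Aff T * (1\<^sub>m f - rel_schur_term)) - A * (F * (1\<^sub>m f - G))"
proof -
  have AJ: "Aff T * rel_schur_term = schur_term" by (simp add: rel_schur_term_def inverse_cancel)
  have AP: "A * P = F * delta_P T + C * (K - Z * delta_P T)"
  proof -
    have "A * P = (F * F\<^sup>T + C * C\<^sup>T) * (A * P)"
      by (simp add: incl_resolution mat_one_dim)
    also have "\<dots> = F * delta_P T + C * (C\<^sup>T * (A * P))"
      by (subst mat_distrib_dim(1)) (simp_all add: mat_assoc_dim delta_P_eq)
    also have "K = Z * delta_P T + C\<^sup>T * (A * P)"
    proof -
      have "K = R * (A * P)" by (simp add: Kmat_def mat_assoc_dim)
      also have "\<dots> = Z * (F\<^sup>T * (A * P)) + C\<^sup>T * (A * P)"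
        unfolding R_eq by (subst mat_distrib_dim(1)) (simp_all add: mat_assoc_dim)
      finally show ?thesis by (simp only: delta_P_eq)
    qed
    then have "C\<^sup>T * (A * P) = K - Z * delta_P T"
      by simp (intro eq_matI; simp del: index_mult_mat(1))
    finally show ?thesis .
  qed
  have APc: "A * (P * coarse_term) = F * schur_term + C * delta_R T - C * (Z * schur_term)"
  proof -
    have "A * (P * coarse_term) = (A * P) * coarse_term" by (simp add: mat_assoc_dim)
    also have "\<dots> = F * schur_term + (C * delta_R T - C * (Z * schur_term))"
      unfolding AP by (simp add: mat_ring_simps K_coarse_term flip: schur_term_def)
    finally show ?thesis by simp (intro eq_matI; simp del: index_mult_mat(1))
  qed
  have AFX: "A * (F * X) = F * (Aff T * X) + C * (Acf T * X)" if "dim_row X = f" for X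
  proof -
    have "A * (F * X) = (A * F) * X" using that by (simp add: mat_assoc_dim)
    then show ?thesis using that by (simp add: A_F mat_ring_simps)
  qed
  show "A * lift = A * (F * (G - rel_schur_term)) - C * (delta_R T * (1\<^sub>m f - rel_schur_term))"
    by (simp add: lift_def mat_ring_simps APc AFX AJ delta_R_def)
      (intro eq_matI; simp del: index_mult_mat(1))
  show "A * lift = (F - C * Z) * (Aff T * (1\<^sub>m f - rel_schur_term)) - A * (F * (1\<^sub>m f - G))"
    by (simp add: lift_def mat_ring_simps APc AFX AJ delta_R_def A_F)
      (intro eq_matI; simp del: index_mult_mat(1))
qed

lemma op_norm_Aff_le: "op_norm (Aff T) \<le> op_norm A"
proof -
  have "op_norm (Aff T) = op_norm (F\<^sup>T * (A * F))" by (simp only: Aff_eq)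
  also have "\<dots> \<le> op_norm (F\<^sup>T) * op_norm (A * F)" by (rule op_norm_mult) simp
  also have "\<dots> \<le> op_norm (F\<^sup>T) * (op_norm A * op_norm F)"
    by (intro mult_left_mono op_norm_mult) simp_all
  also have "\<dots> \<le> 1 * (op_norm A * 1)"
    by (intro mult_mono) (simp_all add: op_norm_incl)
  finally show ?thesis by simp
qed

lemma op_norm_rel_schur_term_le:
  assumes "op_norm (delta_F T) \<le> r" "op_norm G \<le> r" "r < 1"
  shows "op_norm rel_schur_term \<le> 2 * r / (1 - r)"
proof -
  have "op_norm rel_schur_term \<le> op_norm (delta_F T * rel_schur_term) + op_norm (G - delta_F T)"
    by (subst rel_schur_term_fixed_point) (rule op_norm_add; simp)
  also have "\<dots> \<le> op_norm (delta_F T) * op_norm rel_schur_term + (op_norm G + op_norm (delta_F T))"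
    by (intro add_mono op_norm_mult op_norm_minus) simp_all
  also have "\<dots> \<le> r * op_norm rel_schur_term + (r + r)"
    using assms by (intro add_mono mult_right_mono) simp_all
  finally have "op_norm rel_schur_term * (1 - r) \<le> 2 * r" by (simp add: algebra_simps)
  then show ?thesis using assms by (simp add: pos_le_divide_eq)
qed

text \<open>For a vector \<open>F x\<close> the approximation property gives \<open>\<parallel>x\<parallel> \<le> C\<^sub>W \<parallel>x\<parallel>\<close>, as \<open>V F = I\<close>. So
  \<open>C\<^sub>W\<close> is at least 1 unless there are no F-points; arguing with vectors covers that case as well.\<close>

lemma op_norm_delta_R_le:
  assumes wap: "weak_approx_property (A\<^sup>T * A) P Cp" and A: "0 < op_norm A"
    and small: "C_W T Cp * op_norm (delta_R T) \<le> op_norm A"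
  shows "op_norm (delta_R T) \<le> op_norm A"
proof (rule op_norm_leI)
  fix x :: "real vec" assume "x \<in> carrier_vec (dim_col (delta_R T))"
  then have x: "x \<in> carrier_vec f" by simp
  have Fx: "F *\<^sub>v x \<in> carrier_vec (f + c)" by (intro carrier_vecI) simp
  have cw: "0 \<le> C_W T Cp"
    using wap_const_nonneg[OF wap A] by (simp add: C_W_def)
  have "x = (V * F) *\<^sub>v x" 
    using one_mult_mat_vec[OF x] by (simp add: interp_defect_incl_F block_carriers)
  also have "\<dots> = V *\<^sub>v (F *\<^sub>v x)" using x by (intro mat_vec_dim) simp_all
  finally have "vec_norm2 x = vec_norm2 (V *\<^sub>v (F *\<^sub>v x))" by (rule arg_cong)
  also have "\<dots> \<le> C_W T Cp / op_norm A * vec_norm2 (A *\<^sub>v (F *\<^sub>v x))"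
    unfolding C_W_def
    by (rule wap_interp_defect_le[OF block_carriers(5) _ A wap[unfolded P_eq] Fx]) simp
  also have "\<dots> \<le> C_W T Cp / op_norm A * (op_norm A * vec_norm2 (F *\<^sub>v x))"
    using cw A Fx by (intro mult_left_mono op_norm_bound) simp_all
  also have "\<dots> = C_W T Cp * vec_norm2 x"
    using A x by (simp add: vec_norm2_incl)
  finally have lower: "vec_norm2 x \<le> C_W T Cp * vec_norm2 x" .
  have "vec_norm2 (delta_R T *\<^sub>v x) \<le> op_norm (delta_R T) * vec_norm2 x"
    using x by (intro op_norm_bound) simp
  also have "\<dots> \<le> op_norm (delta_R T) * (C_W T Cp * vec_norm2 x)"
    by (intro mult_left_mono lower) simp
  also have "\<dots> \<le> op_norm A * vec_norm2 x"
    using mult_right_mono[OF small vec_norm2_nonneg[of x]] by (simp add: ac_simps)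
  finally show "vec_norm2 (delta_R T *\<^sub>v x) \<le> op_norm A * vec_norm2 x" .
qed simp

lemma op_norm_one_minus: "op_norm (1\<^sub>m f - M) \<le> 1 + op_norm M" if "dim_row M = f" "dim_col M = f"
  using op_norm_minus[of "1\<^sub>m f" M] op_norm_one[of f] that by simp

lemma op_norm_A_lift_le:
  assumes dR: "op_norm (delta_R T) \<le> op_norm A"
    and G: "op_norm G \<le> r" and rel_schur_term: "op_norm rel_schur_term \<le> j"
  shows "op_norm (A * lift) \<le> op_norm A * (r + j) + op_norm A * (1 + j)"
proof -
  have j: "0 \<le> j" and r: "0 \<le> r" using order_trans[OF op_norm_nonneg] rel_schur_term G by blast+
  have "op_norm (A * (F * (G - rel_schur_term))) \<le> op_norm A * (op_norm F * op_norm (G - rel_schur_term))"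
    by (intro order_trans[OF op_norm_mult] mult_left_mono op_norm_mult) simp_all
  also have "\<dots> \<le> op_norm A * (1 * (r + j))"
    using order_trans[OF op_norm_minus[of G rel_schur_term] add_mono[OF G rel_schur_term]] r j
    by (intro mult_left_mono mult_mono) (simp_all add: op_norm_incl)
  finally have 1: "op_norm (A * (F * (G - rel_schur_term))) \<le> op_norm A * (r + j)" by simp
  have "op_norm (C * (delta_R T * (1\<^sub>m f - rel_schur_term))) \<le> op_norm C * (op_norm (delta_R T) * op_norm (1\<^sub>m f - rel_schur_term))"
    by (intro order_trans[OF op_norm_mult] mult_left_mono op_norm_mult) simp_all
  also have "\<dots> \<le> 1 * (op_norm A * (1 + j))"
    using order_trans[OF op_norm_one_minus[of rel_schur_term] add_left_mono[OF rel_schur_term]] j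
    by (intro mult_mono dR) (simp_all add: op_norm_incl)
  finally have 2: "op_norm (C * (delta_R T * (1\<^sub>m f - rel_schur_term))) \<le> op_norm A * (1 + j)" by simp
  have "op_norm (A * lift) \<le> op_norm (A * (F * (G - rel_schur_term))) + op_norm (C * (delta_R T * (1\<^sub>m f - rel_schur_term)))"
    unfolding A_lift(1) by (rule op_norm_minus) simp_all
  then show ?thesis using 1 2 by simp
qed

lemma op_norm_V_inv_A_le:
  assumes "weak_approx_property (A\<^sup>T * A) P Cp" and "0 < op_norm A"
  shows "op_norm (V * mat_inv A) \<le> C_W T Cp / op_norm A"
  unfolding C_W_def
  by (rule wap_interp_defect_inverse[OF block_carriers(5) _ assms(2) inverses(3,1)])
    (use assms P_eq in \<open>auto intro!: carrier_matI\<close>)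

text \<open>Transposition exchanges restriction and interpolation: \<open>R\<^sup>T = F Z\<^sup>T + C\<close>, and
  \<open>(F - C Z)\<^sup>T\<close> is the interpolation defect of \<open>Z\<^sup>T\<close>.\<close>

lemma op_norm_inv_A_restriction_defect_le:
  assumes wap: "weak_approx_property (A * A\<^sup>T) (R\<^sup>T) Cr" and A: "0 < op_norm A"
  shows "op_norm (mat_inv A * (F - C * Z)) \<le> sqrt (Cr * (1 + (op_norm Z)\<^sup>2)) / op_norm A"
proof -
  have tr: "(mat_inv A * (F - C * Z))\<^sup>T = interp_defect f c (Z\<^sup>T) * (mat_inv A)\<^sup>T"
    by (simp add: transpose_mult_dim interp_defect_def transpose_minus[where nr="f + c" and nc=f] carrier_matI)
  have RT: "R\<^sup>T = F * Z\<^sup>T + C"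
    unfolding R_eq by (subst transpose_add[where nr=c and nc="f + c"])
      (auto simp: transpose_mult_dim intro!: carrier_matI)
  have "A\<^sup>T * (mat_inv A)\<^sup>T = (mat_inv A * A)\<^sup>T" by (simp add: transpose_mult_dim)
  then have inv: "A\<^sup>T * (mat_inv A)\<^sup>T = 1\<^sub>m (f + c)" by (simp add: inverses)
  have "op_norm (interp_defect f c (Z\<^sup>T) * (mat_inv A)\<^sup>T)
      \<le> sqrt (Cr * (1 + (op_norm (Z\<^sup>T))\<^sup>2)) / op_norm (A\<^sup>T)"
    by (rule wap_interp_defect_inverse[OF _ _ _ _ inv])
      (use wap A in \<open>auto simp: RT intro!: carrier_matI\<close>)
  then show ?thesis unfolding tr[symmetric] by simp
qed

lemma op_norm_lift_le:
  assumes wap: "weak_approx_property (A * A\<^sup>T) (R\<^sup>T) Cr" and A: "0 < op_norm A"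
    and G: "op_norm G \<le> r" and rel_schur_term: "op_norm rel_schur_term \<le> j"
  shows "op_norm lift \<le> sqrt (Cr * (1 + (op_norm Z)\<^sup>2)) * (1 + j) + (1 + r)"
proof -
  let ?Y = "mat_inv A * (F - C * Z)" and ?c = "sqrt (Cr * (1 + (op_norm Z)\<^sup>2))"
  have j: "0 \<le> j" and r: "0 \<le> r" using order_trans[OF op_norm_nonneg] rel_schur_term G by blast+
  have Y: "op_norm ?Y \<le> ?c / op_norm A" by (rule op_norm_inv_A_restriction_defect_le[OF wap A])
  have "lift = mat_inv A * (A * lift)" by (simp add: inverse_cancel)
  also have "\<dots> = mat_inv A * ((F - C * Z) * (Aff T * (1\<^sub>m f - rel_schur_term))) - mat_inv A * (A * (F * (1\<^sub>m f - G)))"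
    unfolding A_lift(2) by (rule mat_distrib_dim(4)) simp_all
  also have "\<dots> = ?Y * (Aff T * (1\<^sub>m f - rel_schur_term)) - F * (1\<^sub>m f - G)"
    by (subst inverse_cancel) (simp_all add: mat_assoc_dim)
  finally have lift: "lift = ?Y * (Aff T * (1\<^sub>m f - rel_schur_term)) - F * (1\<^sub>m f - G)" .
  have "op_norm (?Y * (Aff T * (1\<^sub>m f - rel_schur_term))) \<le> op_norm ?Y * (op_norm (Aff T) * op_norm (1\<^sub>m f - rel_schur_term))"
    by (intro order_trans[OF op_norm_mult] mult_left_mono op_norm_mult) simp_all
  also have "\<dots> \<le> ?c / op_norm A * (op_norm A * (1 + j))"
    using order_trans[OF op_norm_one_minus[of rel_schur_term] add_left_mono[OF rel_schur_term]] A order_trans[OF op_norm_nonneg Y]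
    by (intro mult_mono Y op_norm_Aff_le) simp_all
  finally have 1: "op_norm (?Y * (Aff T * (1\<^sub>m f - rel_schur_term))) \<le> ?c * (1 + j)" using A by simp
  have "op_norm (F * (1\<^sub>m f - G)) \<le> op_norm F * op_norm (1\<^sub>m f - G)"
    by (rule op_norm_mult) simp
  also have "\<dots> \<le> 1 * (1 + r)"
    using order_trans[OF op_norm_one_minus[of G] add_left_mono[OF G]] r
    by (intro mult_mono) (simp_all add: op_norm_incl)
  finally have 2: "op_norm (F * (1\<^sub>m f - G)) \<le> 1 + r" by simp
  have "op_norm lift \<le> op_norm (?Y * (Aff T * (1\<^sub>m f - rel_schur_term))) + op_norm (F * (1\<^sub>m f - G))"
    by (subst lift) (rule op_norm_minus; simp)
  then show ?thesis using 1 2 by simp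
qed

end

section \<open>Uniform convergence over the family\<close>

lemma sqrt_weak_const_mono:
  assumes "C \<le> c" "0 \<le> w" "w \<le> (W::real)" "0 \<le> c"
  shows "sqrt (C * (1 + w\<^sup>2)) \<le> sqrt (c * (1 + W\<^sup>2))"
  using assms by (intro real_sqrt_le_mono mult_mono add_left_mono power_mono) auto

text \<open>Dropping this summand from the assumed bound leaves \<open>\<parallel>\<delta>\<^sub>F\<parallel> \<le> \<rho>\<close>.\<close>

lemma perturbation_summand_nonneg:
  fixes x y a :: real
  assumes "0 \<le> x" "0 \<le> y" "y < a"
  shows "0 \<le> (1 + x) * (y / (a - y))"
  using assms by (intro mult_nonneg_nonneg divide_nonneg_nonneg) auto

theorem corollary3p7:
  fixes T :: "'i \<Rightarrow> two_grid"
    and C_P C_R :: "'i \<Rightarrow> real"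
    and \<rho> a b :: real
  assumes "\<And>i. two_grid_problem (T i)"
    and "0 < a"
    and "\<And>i. a \<le> op_norm (Amat (T i)) \<and> op_norm (Amat (T i)) \<le> b"
    and "\<And>i. weak_approx_property (transpose_mat (Amat (T i)) * Amat (T i)) (Pmat (T i)) (C_P i)"
    and "bdd_above (range C_P)"
    and "bdd_above (range (\<lambda>i. op_norm (Wmat (T i))))"
    and "\<And>i. C_W (T i) (C_P i) * op_norm (delta_R (T i)) < op_norm (Amat (T i))"
    and "\<And>i. op_norm (Gmat (T i)) \<le> op_norm (delta_F (T i)) + (1 + op_norm (delta_F (T i))) *
             (C_W (T i) (C_P i) * op_norm (delta_R (T i)) /
              (op_norm (Amat (T i)) - C_W (T i) (C_P i) * op_norm (delta_R (T i))))"
    and "\<And>i. op_norm (delta_F (T i)) + (1 + op_norm (delta_F (T i))) *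
             (C_W (T i) (C_P i) * op_norm (delta_R (T i)) /
              (op_norm (Amat (T i)) - C_W (T i) (C_P i) * op_norm (delta_R (T i)))) \<le> \<rho>"
    and "\<rho> < 1"
    and "bdd_above (range (\<lambda>i. cond_num (Aff (T i))))"
    and "bdd_above (range (\<lambda>i. cond_num (DeltaF (T i))))"
  shows "((\<exists>M. \<forall>i k. op_norm (residual_prop (T i) ^\<^sub>m k) \<le> M) \<and>
          (\<forall>i. (\<lambda>k. op_norm (residual_prop (T i) ^\<^sub>m k)) \<longlonglongrightarrow> 0) \<and>
          (\<forall>i. limsup (\<lambda>k. ereal (root k (op_norm (residual_prop (T i) ^\<^sub>m k)))) \<le> ereal \<rho>))
       \<and> ((\<forall>i. weak_approx_property (Amat (T i) * transpose_mat (Amat (T i)))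
                  (transpose_mat (Rmat (T i))) (C_R i)) \<and>
          bdd_above (range C_R) \<and>
          bdd_above (range (\<lambda>i. op_norm (Zmat (T i))))
          \<longrightarrow>
          (\<exists>M. \<forall>i k. op_norm (error_prop (T i) ^\<^sub>m k) \<le> M) \<and>
          (\<forall>i. (\<lambda>k. op_norm (error_prop (T i) ^\<^sub>m k)) \<longlonglongrightarrow> 0) \<and>
          (\<forall>i. limsup (\<lambda>k. ereal (root k (op_norm (error_prop (T i) ^\<^sub>m k)))) \<le> ereal \<rho>))"
proof -
  define j where "j = 2 * \<rho> / (1 - \<rho>)"
  note problem = assms(1) and norm_A = assms(3) and wap = assms(4)
  interpret two_grid_step "T i" for i by unfold_locales (rule problem)
  have A_pos: "0 < op_norm (Amat (T i))" for i using \<open>0 < a\<close> norm_A[of i] by linarith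
  have Cp0: "0 \<le> C_P i" for i by (rule wap_const_nonneg[OF wap A_pos])
  have CW0: "0 \<le> C_W (T i) (C_P i)" for i using Cp0[of i] by (simp add: C_W_def)
  obtain cp where "\<And>i. C_P i \<le> cp" using assms(5) by (auto simp: bdd_above_def)
  note cp = this order_trans[OF Cp0 this]
  obtain w where w: "\<And>i. op_norm (Wmat (T i)) \<le> w" using assms(6) by (auto simp: bdd_above_def)
  have excess: "0 \<le> (1 + op_norm (delta_F (T i))) * (C_W (T i) (C_P i) * op_norm (delta_R (T i)) /
      (op_norm (Amat (T i)) - C_W (T i) (C_P i) * op_norm (delta_R (T i))))" for i
    by (intro perturbation_summand_nonneg mult_nonneg_nonneg CW0 assms(7)) simp_all
  have dF: "op_norm (delta_F (T i)) \<le> \<rho>" and G: "op_norm (Gmat (T i)) \<le> \<rho>" for i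
    using excess[of i] assms(8,9)[of i] by linarith+
  have r: "0 \<le> \<rho>" using dF[of undefined] op_norm_nonneg order_trans by blast
  have rel_schur_term: "op_norm (rel_schur_term i) \<le> j" for i
    unfolding j_def by (rule op_norm_rel_schur_term_le[OF dF G \<open>\<rho> < 1\<close>])
  have j: "0 \<le> j" using order_trans[OF op_norm_nonneg rel_schur_term] .
  have dR: "op_norm (delta_R (T i)) \<le> op_norm (Amat (T i))" for i
    by (rule op_norm_delta_R_le[OF wap A_pos less_imp_le[OF assms(7)]])
  have AL: "op_norm (Amat (T i) * lift i) \<le> b * (\<rho> + j) + b * (1 + j)" for i
  proof -
    have "op_norm (Amat (T i) * lift i) \<le> op_norm (Amat (T i)) * (\<rho> + j) + op_norm (Amat (T i)) * (1 + j)"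
      by (rule op_norm_A_lift_le[OF dR G rel_schur_term])
    also have "\<dots> \<le> b * (\<rho> + j) + b * (1 + j)"
      using norm_A[of i] r j by (intro add_mono mult_right_mono) auto
    finally show ?thesis .
  qed
  have VA: "op_norm (interp_defect (nF (T i)) (nC (T i)) (Wmat (T i)) * mat_inv (Amat (T i)))
      \<le> sqrt (cp * (1 + w\<^sup>2)) / a" for i
  proof -
    have "C_W (T i) (C_P i) \<le> sqrt (cp * (1 + w\<^sup>2))"
      unfolding C_W_def using cp w by (intro sqrt_weak_const_mono) simp_all
    then have "C_W (T i) (C_P i) / op_norm (Amat (T i)) \<le> sqrt (cp * (1 + w\<^sup>2)) / a"
      using norm_A[of i] \<open>0 < a\<close> cp(2) by (intro frac_le) simp_all
    then show ?thesis using op_norm_V_inv_A_le[OF wap A_pos, of i] by linarith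
  qed
  have residual: "(\<exists>M. \<forall>i k. op_norm (residual_prop (T i) ^\<^sub>m k) \<le> M) \<and>
          (\<forall>i. (\<lambda>k. op_norm (residual_prop (T i) ^\<^sub>m k)) \<longlonglongrightarrow> 0) \<and>
          (\<forall>i. limsup (\<lambda>k. ereal (root k (op_norm (residual_prop (T i) ^\<^sub>m k)))) \<le> ereal \<rho>)"
    by (rule uniform_power_convergence[OF residual_prop_factored V_inv_A_lift _ _ AL VA G \<open>\<rho> < 1\<close>])
      simp_all
  have error: "(\<exists>M. \<forall>i k. op_norm (error_prop (T i) ^\<^sub>m k) \<le> M) \<and>
          (\<forall>i. (\<lambda>k. op_norm (error_prop (T i) ^\<^sub>m k)) \<longlonglongrightarrow> 0) \<and>
          (\<forall>i. limsup (\<lambda>k. ereal (root k (op_norm (error_prop (T i) ^\<^sub>m k)))) \<le> ereal \<rho>)"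
    if wap_R: "\<forall>i. weak_approx_property (Amat (T i) * transpose_mat (Amat (T i))) (transpose_mat (Rmat (T i))) (C_R i)"
      and C_R: "bdd_above (range C_R)" and Z: "bdd_above (range (\<lambda>i. op_norm (Zmat (T i))))"
  proof -
    have wapR: "weak_approx_property (Amat (T i) * (Amat (T i))\<^sup>T) ((Rmat (T i))\<^sup>T) (C_R i)" for i
      using wap_R by blast
    have Cr0: "0 \<le> C_R i" for i
      using wap_const_nonneg[of "(Amat (T i))\<^sup>T"] wapR[of i] A_pos[of i] by simp
    obtain cr where "\<And>i. C_R i \<le> cr" using C_R by (auto simp: bdd_above_def)
    note cr = this order_trans[OF Cr0 this]
    obtain z where z: "\<And>i. op_norm (Zmat (T i)) \<le> z" using Z by (auto simp: bdd_above_def)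
    have lift: "op_norm (lift i) \<le> sqrt (cr * (1 + z\<^sup>2)) * (1 + j) + (1 + \<rho>)" for i
    proof -
      have "op_norm (lift i) \<le> sqrt (C_R i * (1 + (op_norm (Zmat (T i)))\<^sup>2)) * (1 + j) + (1 + \<rho>)"
        by (rule op_norm_lift_le[OF wapR A_pos G rel_schur_term])
      also have "\<dots> \<le> sqrt (cr * (1 + z\<^sup>2)) * (1 + j) + (1 + \<rho>)"
        using cr z j by (intro add_right_mono mult_right_mono sqrt_weak_const_mono) simp_all
      finally show ?thesis .
    qed
    have V: "op_norm (interp_defect (nF (T i)) (nC (T i)) (Wmat (T i))) \<le> sqrt (1 * (1 + w\<^sup>2))" for i
      using order_trans[OF op_norm_interp_defect[OF block_carriers(5), of i]]
        sqrt_weak_const_mono[of 1 1, OF _ op_norm_nonneg w[of i]] by simp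
    show ?thesis
      by (rule uniform_power_convergence[OF error_prop_factored V_lift _ _ lift V G \<open>\<rho> < 1\<close>]) simp_all
  qed
  show ?thesis using residual error by blast
qed

end
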